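(* Fix $c>0$ and $p>0$. For integers $n>p$, let $A_n$ be the adjacency matrix of a random graph following $\mathrm{G}(n,p/n)$, let $J_n$ be the $n\times n$ matrix all of whose entries equal $1/n$, and let $M_n=D_n^{-1}(cJ_n+A_n)$, where $D_n$ is the diagonal matrix whose $i$-th diagonal entry is $c+\sum_{j=1}^n (A_n)_{ij}$. Let $\lambda_1(M_n)\le\cdots\le\lambda_{n-1}(M_n)<\lambda_n(M_n)=1$ be the eigenvalues of $M_n$. Let $k=\lfloor p\rfloor+1$. Fix an integer $l\ge 1$ and a real number $b$ with $0<b<\tau_c$. Then $$\mathrm{P}\left\{b\le \lambda_{n-l}(M_n)\le \tau_{c/k}\ \text{ and }\ -\tau_{c/k}\le \lambda_l(M_n)\le -b\right\}\to 1\quad\text{as } n\to\infty.$$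
   Context: $\mathrm{G}(n,a)$, for $a\in[0,1]$, denotes the Erdős–Rényi distribution on simple (undirected, loopless, no multiple edges) graphs with vertex set $\{1,\dots,n\}$ in which each pair of distinct vertices is joined by an edge with probability $a$, independently of the other pairs. The adjacency matrix of such a graph has $(i,j)$ entry $1$ if $\{i,j\}$ is an edge and $0$ otherwise. For $c\ge 0$, $\tau_c=1/\sqrt{1+c}$. The matrix $M_n$ is the row-normalized version of $cJ_n+A_n$; it is a stochastic (Markov) matrix similar to a real symmetric matrix, so all its eigenvalues are real; they are listed in increasing order, counted with multiplicity. *)

theory Defs
  imports
    "HOL-Probability.Probability"
    "HOL-Computational_Algebra.Computational_Algebra"
    "Jordan_Normal_Form.Char_Poly"
    "Jordan_Normal_Form.Gauss_Jordan_Elimination"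
begin

text \<open>A simple graph on the vertex set \<open>{1..n}\<close> is identified with its edge set, a set of
  two-element subsets of \<open>{1..n}\<close>.\<close>

definition vertex_pairs :: "nat \<Rightarrow> nat set set" where
  "vertex_pairs n = {e. e \<subseteq> {1..n} \<and> card e = 2}"

definition random_graph :: "nat \<Rightarrow> real \<Rightarrow> nat set set pmf" where
  "random_graph n a =
     map_pmf (\<lambda>f. {e \<in> vertex_pairs n. f e})
       (Pi_pmf (vertex_pairs n) False (\<lambda>_. bernoulli_pmf a))"

text \<open>Matrix indices start at 0, so the matrix index \<open>i\<close> stands for the vertex \<open>Suc i\<close>.\<close>

definition adjacency_mat :: "nat \<Rightarrow> nat set set \<Rightarrow> real mat" where
  "adjacency_mat n E = Matrix.mat n n (\<lambda>(i, j). if {Suc i, Suc j} \<in> E then 1 else 0)"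

definition J_mat :: "nat \<Rightarrow> real mat" where
  "J_mat n = Matrix.mat n n (\<lambda>_. 1 / real n)"

definition D_mat :: "real \<Rightarrow> nat \<Rightarrow> nat set set \<Rightarrow> real mat" where
  "D_mat c n E = mat_diag n (\<lambda>i. c + (\<Sum>j<n. adjacency_mat n E $$ (i, j)))"

text \<open>For \<open>c > 0\<close> the matrix \<open>D_mat c n E\<close> has positive diagonal entries, so that
  \<open>mat_inverse\<close> returns its inverse.\<close>

definition M_mat :: "real \<Rightarrow> nat \<Rightarrow> nat set set \<Rightarrow> real mat" where
  "M_mat c n E = the (mat_inverse (D_mat c n E)) * (c \<cdot>\<^sub>m J_mat n + adjacency_mat n E)"

text \<open>The \<open>i\<close>-th smallest eigenvalue, \<open>i\<close> counted from 1, with algebraic multiplicities.  This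
  is meant for matrices all of whose complex eigenvalues are real, and for
  \<open>1 \<le> i \<le> dim_row A\<close>.\<close>

definition nth_eigenvalue :: "nat \<Rightarrow> real mat \<Rightarrow> real" where
  "nth_eigenvalue i A = sorted_list_of_multiset (proots (char_poly A)) ! (i - 1)"

definition tau :: "real \<Rightarrow> real" where
  "tau c = 1 / sqrt (1 + c)"

end

theory Submission
  imports Defs "Jordan_Normal_Form.Jordan_Normal_Form_Existence" "HOL-Real_Asymp.Real_Asymp"
begin

text \<open>
  Let \<open>w i = c + d i\<close> be the diagonal of \<open>D\<close>.  The matrix \<open>M\<close> is self-adjoint for the inner
  product with weights \<open>w\<close>, hence diagonalizable over the reals, and its quadratic form is
  \<open>(c / n) (\<Sum>i. x i)\<^sup>2 + (\<Sum>i j. A i j x i x j)\<close>.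

  Upper bounds.  If the edges can be oriented with out-degrees at most \<open>k\<close>, then with
  \<open>t = tau (c / k)\<close> the inequality \<open>2 x y \<le> x\<^sup>2 / t + t y\<^sup>2\<close>, used along each oriented edge, bounds the
  adjacency form by \<open>t (\<Sum>i. w i (x i)\<^sup>2)\<close> in absolute value, because \<open>1 / t\<^sup>2 = 1 + c / k\<close>.  The
  \<open>J\<close>-part is positive semidefinite of rank one, so no eigenvalue is below \<open>- t\<close> and at most one
  exceeds \<open>t\<close>.  Such an orientation exists with high probability: colouring the edges uniformly with
  \<open>k > p\<close> colours makes each colour class a subcritical random graph with edge probability
  \<open>p / (k n)\<close>, whose components have at most one cycle, so that it can be oriented with out-degrees
  at most one.

  Lower bounds.  On isolated stars with \<open>m\<close> leaves let \<open>\<theta> = \<plusminus> sqrt (m / ((m + c) (1 + c)))\<close>, which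
  tends to \<open>\<plusminus> tau c\<close> as \<open>m\<close> grows.  The function that is \<open>\<theta> (1 + c)\<close> at the centre and 1 at the
  leaves of one star, minus its copy on another star, has sum zero and is an eigenvector of \<open>M\<close> for
  \<open>\<theta>\<close>.  A second-moment computation gives arbitrarily many isolated stars with high probability.
\<close>

section \<open>Symmetrizable matrices\<close>

lemma underdetermined_system:
  fixes a :: "'j \<Rightarrow> 't \<Rightarrow> 'a::field"
  assumes "finite J" "finite T" "card J < card T"
  shows "\<exists>\<alpha>. (\<exists>t\<in>T. \<alpha> t \<noteq> 0) \<and> (\<forall>j\<in>J. (\<Sum>t\<in>T. a j t * \<alpha> t) = 0)"
  using assms
proof (induction J arbitrary: T a rule: finite_induct)
  case empty
  then have "T \<noteq> {}" by auto
  then show ?case by (intro exI[of _ "\<lambda>_. 1"]) auto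
next
  case (insert j J)
  show ?case
  proof (cases "\<forall>t\<in>T. a j t = 0")
    case True
    have "card J < card T" using insert by simp
    from insert.IH[OF insert.prems(1) this, of a] True show ?thesis by auto
  next
    case False
    then obtain s where s: "s \<in> T" "a j s \<noteq> 0" by auto
    define a' where "a' i t = a i t - a i s * a j t / a j s" for i t
    have "card J < card (T - {s})" using insert s by simp
    from insert.IH[OF _ this, of a'] insert.prems(1) obtain \<alpha>'
      where 1: "\<exists>t\<in>T - {s}. \<alpha>' t \<noteq> 0"
        and 2: "\<forall>i\<in>J. (\<Sum>t\<in>T - {s}. a' i t * \<alpha>' t) = 0" by auto
    define z where "z = (\<Sum>t\<in>T - {s}. a j t * \<alpha>' t)"
    define \<alpha> where "\<alpha> = \<alpha>'(s := - z / a j s)"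
    have sp: "(\<Sum>t\<in>T. a i t * \<alpha> t) = (\<Sum>t\<in>T - {s}. a i t * \<alpha>' t) - a i s * (z / a j s)" for i
    proof -
      have "(\<Sum>t\<in>T. a i t * \<alpha> t) = a i s * \<alpha> s + (\<Sum>t\<in>T - {s}. a i t * \<alpha> t)"
        using s insert.prems(1) by (simp add: sum.remove)
      also have "(\<Sum>t\<in>T - {s}. a i t * \<alpha> t) = (\<Sum>t\<in>T - {s}. a i t * \<alpha>' t)"
        by (rule sum.cong) (auto simp: \<alpha>_def)
      finally show ?thesis by (simp add: \<alpha>_def)
    qed
    have "(\<Sum>t\<in>T. a i t * \<alpha> t) = 0" if "i \<in> insert j J" for i
    proof (cases "i = j")
      case True
      then show ?thesis using s by (simp add: sp z_def)
    next
      case False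
      with that have "0 = (\<Sum>t\<in>T - {s}. a' i t * \<alpha>' t)" using 2 by simp
      also have "\<dots> = (\<Sum>t\<in>T - {s}. a i t * \<alpha>' t) - a i s * (z / a j s)"
        by (simp add: a'_def z_def sum_subtractf sum_distrib_left sum_divide_distrib algebra_simps)
      finally show ?thesis by (simp add: sp)
    qed
    moreover have "\<exists>t\<in>T. \<alpha> t \<noteq> 0" using 1 by (auto simp: \<alpha>_def)
    ultimately show ?thesis by blast
  qed
qed

locale symmetrizable_matrix =
  fixes n :: nat and M :: "real mat" and w :: "nat \<Rightarrow> real"
  assumes M: "M \<in> carrier_mat n n"
    and w: "\<And>i. i < n \<Longrightarrow> 0 < w i"
    and sym: "\<And>i j. i < n \<Longrightarrow> j < n \<Longrightarrow> w i * M $$ (i, j) = w j * M $$ (j, i)"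

lemma (in symmetrizable_matrix) char_poly_splits:
  "\<exists>as. char_poly M = (\<Prod>a\<leftarrow>as. [:- a, 1:]) \<and> length as = n"
proof -
  define Mc where "Mc = map_mat complex_of_real M"
  have Mc: "Mc \<in> carrier_mat n n" using M by (simp add: Mc_def)
  from char_poly_factorized[OF Mc] obtain as
    where as: "char_poly Mc = (\<Prod>a\<leftarrow>as. [:- a, 1:])" "length as = n" by auto
  have real: "of_real (Re a) = a" if "a \<in> set as" for a
  proof -
    have "poly (char_poly Mc) a = 0"
      using that by (auto simp: as poly_prod_list prod_list_zero_iff)
    then have "eigenvalue Mc a" using eigenvalue_root_char_poly[OF Mc] by simp
    then obtain z where "eigenvector Mc z a" unfolding eigenvalue_def by auto
    then have z: "z \<in> carrier_vec n" "z \<noteq> 0\<^sub>v n" "Mc *\<^sub>v z = a \<cdot>\<^sub>v z"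
      using Mc by (auto simp: eigenvector_def)
    define B where "B i j = w i * M $$ (i, j)" for i j
    have ev: "(\<Sum>j<n. of_real (M $$ (i, j)) * z $ j) = a * z $ i" if "i < n" for i
    proof -
      have "(Mc *\<^sub>v z) $ i = (\<Sum>j<n. of_real (M $$ (i, j)) * z $ j)"
        using that M z(1) by (auto simp: Mc_def scalar_prod_def atLeast0LessThan intro!: sum.cong)
      then show ?thesis using z that by simp
    qed
    define s where "s = (\<Sum>i<n. \<Sum>j<n. of_real (B i j) * z $ j * cnj (z $ i))"
    define r where "r = (\<Sum>i<n. w i * (cmod (z $ i))\<^sup>2)"
    have "s = (\<Sum>i<n. of_real (w i) * cnj (z $ i) * (\<Sum>j<n. of_real (M $$ (i, j)) * z $ j))"
      by (simp add: s_def B_def sum_distrib_left sum_distrib_right mult_ac)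
    also have "\<dots> = (\<Sum>i<n. of_real (w i) * cnj (z $ i) * (a * z $ i))"
      by (rule sum.cong) (auto simp: ev)
    also have "\<dots> = a * of_real r"
      by (simp add: r_def sum_distrib_left complex_norm_square mult_ac del: of_real_power)
    finally have sa: "s = a * of_real r" .
    have "cnj s = (\<Sum>i<n. \<Sum>j<n. of_real (B i j) * cnj (z $ j) * z $ i)"
      by (simp add: s_def)
    also have "\<dots> = (\<Sum>j<n. \<Sum>i<n. of_real (B i j) * cnj (z $ j) * z $ i)"
      by (rule sum.swap)
    also have "\<dots> = s"
      unfolding s_def using sym by (intro sum.cong) (auto simp: B_def mult_ac)
    finally have "cnj s = s" .
    with sa have "(cnj a - a) * of_real r = 0" by (simp add: algebra_simps)
    moreover have "r > 0"
    proof -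
      from z(1,2) obtain i where i: "i < n" "z $ i \<noteq> 0" by (metis carrier_vecD index_zero_vec(1) eq_vecI index_zero_vec(2))
      show ?thesis unfolding r_def
        by (rule sum_pos2[of _ i]) (use i w in \<open>auto simp: less_imp_le\<close>)
    qed
    ultimately have "cnj a = a" by simp
    then show ?thesis by (simp add: complex_eq_iff)
  qed
  interpret h: map_poly_inj_comm_ring_hom "of_real :: real \<Rightarrow> complex" ..
  define bs where "bs = map Re as"
  have "map_poly complex_of_real (char_poly M) = char_poly Mc"
    unfolding Mc_def by (rule of_real_hom.char_poly_hom[OF M, symmetric])
  also have "\<dots> = (\<Prod>a\<leftarrow>as. map_poly of_real [:- Re a, 1:])"
    unfolding as using real by (intro arg_cong[where f = prod_list] map_cong) auto
  also have "\<dots> = map_poly of_real (\<Prod>b\<leftarrow>bs. [:- b, 1:])"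
    unfolding bs_def
    by (simp add: h.hom_prod_list o_def)
  finally have "map_poly complex_of_real (char_poly M) = map_poly of_real (\<Prod>b\<leftarrow>bs. [:- b, 1:])" .
  then have "char_poly M = (\<Prod>b\<leftarrow>bs. [:- b, 1:])" by simp
  then show ?thesis using as(2) by (intro exI[of _ bs]) (simp add: bs_def)
qed

lemma jordan_matrix_diagonal_or_chain:
  fixes n_as :: "(nat \<times> 'a::{zero,one}) list"
  defines "J \<equiv> jordan_matrix n_as"
  defines "N \<equiv> sum_list (map fst n_as)"
  shows "(\<forall>i<N. \<forall>j<N. i \<noteq> j \<longrightarrow> J $$ (i, j) = 0) \<or>
    (\<exists>i e. Suc i < N \<and> (\<forall>r<N. J $$ (r, i) = (if r = i then e else 0)) \<and>
       (\<forall>r<N. J $$ (r, Suc i) = (if r = Suc i then e else if r = i then 1 else 0)))"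
  unfolding J_def N_def
proof (induction n_as)
  case Nil
  then show ?case by simp
next
  case (Cons x n_as)
  obtain k a where x: "x = (k, a)" by force
  let ?J = "jordan_matrix n_as" and ?N = "sum_list (map fst n_as)"
  have ix: "jordan_matrix (x # n_as) $$ (i, j) =
      (if i < k then if j < k then jordan_block k a $$ (i, j) else 0
       else if j < k then 0 else ?J $$ (i - k, j - k))" if "i < k + ?N" "j < k + ?N" for i j
    using that jordan_matrix_dim[of n_as, unfolded jordan_matrix_def]
    by (auto simp: x jordan_matrix_def Let_def)
  show ?case
  proof (cases "k \<ge> 2")
    case True
    then show ?thesis
      by (intro disjI2, rule_tac x = 0 in exI, rule_tac x = a in exI) (auto simp: x ix[unfolded x])
  next
    case False
    from Cons show ?thesis
    proof (elim disjE exE conjE)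
      assume *: "\<forall>i<?N. \<forall>j<?N. i \<noteq> j \<longrightarrow> ?J $$ (i, j) = 0"
      show ?thesis using False * by (intro disjI1) (auto simp: x ix[unfolded x])
    next
      fix i e
      assume *: "Suc i < ?N" "\<forall>r<?N. ?J $$ (r, i) = (if r = i then e else 0)"
        "\<forall>r<?N. ?J $$ (r, Suc i) = (if r = Suc i then e else if r = i then 1 else 0)"
      show ?thesis
        by (intro disjI2 exI[of _ "k + i"] exI[of _ e]) (use * in \<open>auto simp: x ix[unfolded x] Suc_diff_le\<close>)
    qed
  qed
qed

lemma (in symmetrizable_matrix) diagonalization:
  "\<exists>(es :: real list) p q. length es = n \<and> proots (char_poly M) = mset es \<and>
    (\<forall>i<n. \<forall>j<n. (\<Sum>k<n. M $$ (i, k) * p k j) = es ! j * p i j) \<and>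
    (\<forall>i<n. \<forall>j<n. (\<Sum>k<n. q i k * M $$ (k, j)) = es ! i * q i j) \<and>
    (\<forall>i<n. \<forall>j<n. (\<Sum>k<n. q i k * p k j) = (if i = j then 1 else 0)) \<and>
    (\<forall>i<n. \<forall>j<n. (\<Sum>k<n. p i k * q k j) = (if i = j then 1 else 0))"
proof -
  from char_poly_splits obtain as
    where "char_poly M = (\<Prod>a\<leftarrow>as. [:- a, 1:])" by auto
  from jordan_nf_exists[OF M this] obtain n_as where "jordan_nf M n_as" by auto
  then have "similar_mat M (jordan_matrix n_as)" by (simp add: jordan_nf_def)
  then obtain P Q where wit: "similar_mat_wit M (jordan_matrix n_as) P Q"
    by (auto simp: similar_mat_def)
  define J where "J = jordan_matrix n_as"
  from similar_mat_witD2[OF M wit[folded J_def]]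
  have PQ: "P * Q = 1\<^sub>m n" "Q * P = 1\<^sub>m n" "M = P * J * Q"
    and J: "J \<in> carrier_mat n n" and P: "P \<in> carrier_mat n n" and Q: "Q \<in> carrier_mat n n"
    by auto
  have N: "sum_list (map fst n_as) = n" using J by (auto simp: J_def)
  have MP: "M * P = P * J"
  proof -
    have "M * P = P * J * (Q * P)" using PQ(3) P Q J by (simp add: assoc_mult_mat[of _ n n _ n _ n])
    then show ?thesis using PQ P J by simp
  qed
  have QM: "Q * M = J * Q"
  proof -
    have "Q * M = (Q * P) * (J * Q)" using PQ(3) P Q J by (simp add: assoc_mult_mat[of _ n n _ n _ n])
    then show ?thesis using PQ Q J by simp
  qed
  have ix: "(X * Y) $$ (i, j) = (\<Sum>k<n. X $$ (i, k) * Y $$ (k, j))"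
    if "X \<in> carrier_mat n n" "Y \<in> carrier_mat n n" "i < n" "j < n" for X Y :: "real mat" and i j
    using that by (auto simp: scalar_prod_def atLeast0LessThan intro!: sum.cong)
  have MPix: "(\<Sum>k<n. M $$ (i, k) * P $$ (k, j)) = (\<Sum>k<n. P $$ (i, k) * J $$ (k, j))"
    if "i < n" "j < n" for i j
    using arg_cong[OF MP, of "\<lambda>X. X $$ (i, j)"] that M P J by (simp only: ix)
  have diag: "J $$ (i, j) = 0" if "i < n" "j < n" "i \<noteq> j" for i j
  proof (rule ccontr)
    assume "J $$ (i, j) \<noteq> 0"
    with jordan_matrix_diagonal_or_chain[of n_as] that obtain s e
      where s: "Suc s < n" "\<forall>r<n. J $$ (r, s) = (if r = s then e else 0)"
        "\<forall>r<n. J $$ (r, Suc s) = (if r = Suc s then e else if r = s then 1 else 0)"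
      unfolding N J_def[symmetric] by auto
    define u v where "u r = P $$ (r, s)" and "v r = P $$ (r, Suc s)" for r
    have u: "(\<Sum>k<n. M $$ (i, k) * u k) = e * u i" if "i < n" for i
    proof -
      have "(\<Sum>k<n. M $$ (i, k) * u k) = (\<Sum>k<n. P $$ (i, k) * J $$ (k, s))"
        unfolding u_def using MPix[of i s] that s by simp
      also have "\<dots> = (\<Sum>k<n. if k = s then e * u i else 0)"
        by (rule sum.cong) (use s in \<open>auto simp: u_def\<close>)
      finally show ?thesis using s by simp
    qed
    have v: "(\<Sum>k<n. M $$ (i, k) * v k) = e * v i + u i" if "i < n" for i
    proof -
      have "(\<Sum>k<n. M $$ (i, k) * v k) = (\<Sum>k<n. P $$ (i, k) * J $$ (k, Suc s))"
        unfolding v_def using MPix[of i "Suc s"] that s by simp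
      also have "\<dots> = (\<Sum>k<n. (if k = Suc s then e * v i else 0) + (if k = s then u i else 0))"
        by (rule sum.cong) (use s in \<open>auto simp: u_def v_def\<close>)
      finally show ?thesis using s by (simp add: sum.distrib)
    qed
    have "(\<Sum>i<n. w i * u i * (\<Sum>k<n. M $$ (i, k) * v k)) =
        (\<Sum>i<n. \<Sum>k<n. w i * M $$ (i, k) * u i * v k)"
      by (simp add: sum_distrib_left mult_ac)
    also have "\<dots> = (\<Sum>i<n. \<Sum>k<n. w k * M $$ (k, i) * u i * v k)"
      using sym by (intro sum.cong) auto
    also have "\<dots> = (\<Sum>k<n. \<Sum>i<n. w k * M $$ (k, i) * u i * v k)"
      by (rule sum.swap)
    also have "\<dots> = (\<Sum>k<n. w k * v k * (\<Sum>i<n. M $$ (k, i) * u i))"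
      by (simp add: sum_distrib_left mult_ac)
    finally have "(\<Sum>i<n. w i * u i * (e * v i + u i)) = (\<Sum>k<n. w k * v k * (e * u k))"
      by (simp add: u v)
    then have "(\<Sum>i<n. w i * u i * u i) = 0"
      by (simp add: algebra_simps sum.distrib)
    then have z: "\<forall>i\<in>{..<n}. w i * u i * u i = 0"
      using w by (subst (asm) sum_nonneg_eq_0_iff) (auto simp: mult.assoc less_imp_le)
    have "u i = 0" if "i < n" for i using bspec[OF z, of i] w[OF that] that by simp
    then have "(\<Sum>k<n. Q $$ (s, k) * P $$ (k, s)) = 0" by (simp add: u_def)
    moreover have "(\<Sum>k<n. Q $$ (s, k) * P $$ (k, s)) = 1"
      using ix[OF Q P, of s s] PQ s by simp
    ultimately show False by simp
  qed
  define es where "es = diag_mat J"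
  have es: "length es = n" "\<And>i. i < n \<Longrightarrow> es ! i = J $$ (i, i)"
    using J by (auto simp: es_def diag_mat_def)
  have "char_poly M = char_poly J"
    using wit unfolding J_def[symmetric] by (intro char_poly_similar) (auto simp: similar_mat_def)
  also have "\<dots> = (\<Prod>a\<leftarrow>es. [:- a, 1:])"
    unfolding es_def by (rule char_poly_upper_triangular[OF J]) (use J diag in \<open>auto simp: upper_triangular_def\<close>)
  finally have "proots (char_poly M) = proots (\<Prod>p\<leftarrow>map (\<lambda>a. [:- a, 1:]) es. p)"
    by simp
  also have "\<dots> = (\<Sum>p\<leftarrow>map (\<lambda>a. [:- a, 1:]) es. proots p)"
    by (rule proots_prod_list) auto
  also have "\<dots> = mset es"
    by (induction es) simp_all
  finally have roots: "proots (char_poly M) = mset es" .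
  have Jd: "J $$ (i, j) = (if i = j then es ! j else 0)" if "i < n" "j < n" for i j
    using that diag es by auto
  show ?thesis
  proof (rule exI[of _ es], rule exI[of _ "\<lambda>i j. P $$ (i, j)"], rule exI[of _ "\<lambda>i j. Q $$ (i, j)"],
      intro conjI allI impI)
    fix i j assume ij: "i < n" "j < n"
    show "(\<Sum>k<n. M $$ (i, k) * P $$ (k, j)) = es ! j * P $$ (i, j)"
    proof -
      have "(\<Sum>k<n. P $$ (i, k) * J $$ (k, j)) = (\<Sum>k<n. if k = j then es ! j * P $$ (i, j) else 0)"
        by (rule sum.cong) (use Jd ij in auto)
      then show ?thesis using MPix[OF ij] ij by simp
    qed
    show "(\<Sum>k<n. Q $$ (i, k) * M $$ (k, j)) = es ! i * Q $$ (i, j)"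
    proof -
      have "(\<Sum>k<n. J $$ (i, k) * Q $$ (k, j)) = (\<Sum>k<n. if k = i then es ! i * Q $$ (i, j) else 0)"
        by (rule sum.cong) (use Jd ij in auto)
      then show ?thesis using arg_cong[OF QM, of "\<lambda>X. X $$ (i, j)"] ij M Q J by (simp add: ix del: index_mult_mat)
    qed
    show "(\<Sum>k<n. Q $$ (i, k) * P $$ (k, j)) = (if i = j then 1 else 0)"
      using ix[OF Q P ij] PQ ij by simp
    show "(\<Sum>k<n. P $$ (i, k) * Q $$ (k, j)) = (if i = j then 1 else 0)"
      using ix[OF P Q ij] PQ ij by simp
  qed (use es(1) roots in auto)
qed

lemma sorted_nth_ge_if_card:
  fixes es :: "real list"
  assumes "m \<ge> 1" "m \<le> card {j. j < length es \<and> b \<le> es ! j}"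
  shows "b \<le> sort es ! (length es - m)"
proof (rule ccontr)
  assume "\<not> ?thesis"
  define ys where "ys = sort es"
  have len: "length ys = length es" and srt: "sorted ys" by (auto simp: ys_def)
  have "card {j. j < length es \<and> b \<le> es ! j} = size (filter_mset (\<lambda>x. b \<le> x) (mset es))"
    by (simp add: length_filter_conv_card flip: mset_filter)
  also have "\<dots> = size (filter_mset (\<lambda>x. b \<le> x) (mset ys))" by (simp add: ys_def)
  also have "\<dots> = card {j. j < length ys \<and> b \<le> ys ! j}"
    by (simp add: length_filter_conv_card flip: mset_filter)
  finally have eq: "card {j. j < length es \<and> b \<le> es ! j} = card {j. j < length ys \<and> b \<le> ys ! j}" .
  have mle: "m \<le> length es"
    using assms(2) card_mono[of "{..<length es}" "{j. j < length es \<and> b \<le> es ! j}"] by (auto simp: subset_iff)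
  have "{j. j < length ys \<and> b \<le> ys ! j} \<subseteq> {length es - m <..< length es}"
  proof
    fix j assume "j \<in> {j. j < length ys \<and> b \<le> ys ! j}"
    then have j: "j < length ys" "b \<le> ys ! j" by auto
    have "length es - m < j"
    proof (rule ccontr)
      assume "\<not> ?thesis"
      then have "ys ! j \<le> ys ! (length es - m)"
        using srt len mle assms(1) by (intro sorted_nth_mono) auto
      with j \<open>\<not> b \<le> sort es ! (length es - m)\<close> show False by (simp add: ys_def)
    qed
    with j len show "j \<in> {length es - m <..< length es}" by auto
  qed
  from card_mono[OF _ this] have "card {j. j < length ys \<and> b \<le> ys ! j} \<le> m - 1"
    using mle by simp
  with eq assms show False by simp
qed

lemma sorted_nth_le_if_card:
  fixes es :: "real list"
  assumes "m \<ge> 1" "m \<le> card {j. j < length es \<and> es ! j \<le> b}"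
  shows "sort es ! (m - 1) \<le> b"
proof (rule ccontr)
  assume "\<not> ?thesis"
  define ys where "ys = sort es"
  have len: "length ys = length es" and srt: "sorted ys" by (auto simp: ys_def)
  have "card {j. j < length es \<and> es ! j \<le> b} = size (filter_mset (\<lambda>x. x \<le> b) (mset es))"
    by (simp add: length_filter_conv_card flip: mset_filter)
  also have "\<dots> = size (filter_mset (\<lambda>x. x \<le> b) (mset ys))" by (simp add: ys_def)
  also have "\<dots> = card {j. j < length ys \<and> ys ! j \<le> b}"
    by (simp add: length_filter_conv_card flip: mset_filter)
  finally have eq: "card {j. j < length es \<and> es ! j \<le> b} = card {j. j < length ys \<and> ys ! j \<le> b}" .
  have "{j. j < length ys \<and> ys ! j \<le> b} \<subseteq> {..<m - 1}"
  proof
    fix j assume "j \<in> {j. j < length ys \<and> ys ! j \<le> b}"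
    then have j: "j < length ys" "ys ! j \<le> b" by auto
    have "j < m - 1"
    proof (rule ccontr)
      assume "\<not> ?thesis"
      then have "ys ! (m - 1) \<le> ys ! j"
        using srt j by (intro sorted_nth_mono) auto
      with j \<open>\<not> sort es ! (m - 1) \<le> b\<close> show False by (simp add: ys_def)
    qed
    then show "j \<in> {..<m - 1}" by simp
  qed
  from card_mono[OF _ this] have "card {j. j < length ys \<and> ys ! j \<le> b} \<le> m - 1" by simp
  with eq assms show False by simp
qed

context symmetrizable_matrix
begin

definition app :: "(nat \<Rightarrow> real) \<Rightarrow> nat \<Rightarrow> real" where
  "app x i = (\<Sum>k<n. M $$ (i, k) * x k)"

definition ip :: "(nat \<Rightarrow> real) \<Rightarrow> (nat \<Rightarrow> real) \<Rightarrow> real" where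
  "ip x y = (\<Sum>i<n. w i * x i * y i)"

lemma ip_commute: "ip x y = ip y x"
  by (simp add: ip_def mult_ac)

lemma ip_add_left: "ip (\<lambda>i. x i + y i) z = ip x z + ip y z"
  by (simp add: ip_def algebra_simps sum.distrib)

lemma ip_scale_left: "ip (\<lambda>i. a * x i) z = a * ip x z"
  by (simp add: ip_def algebra_simps sum_distrib_left)

lemma ip_add_right: "ip z (\<lambda>i. x i + y i) = ip z x + ip z y"
  by (simp add: ip_def algebra_simps sum.distrib)

lemma ip_scale_right: "ip z (\<lambda>i. a * x i) = a * ip z x"
  by (simp add: ip_def algebra_simps sum_distrib_left)

lemma ip_cong: "(\<And>i. i < n \<Longrightarrow> x i = x' i) \<Longrightarrow> (\<And>i. i < n \<Longrightarrow> y i = y' i) \<Longrightarrow> ip x y = ip x' y'"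
  by (simp add: ip_def)

lemma ip_nonneg: "0 \<le> ip x x"
  unfolding ip_def mult.assoc
  by (rule sum_nonneg) (use w in \<open>auto simp: zero_le_mult_iff less_imp_le\<close>)

lemma ip_pos:
  assumes "i < n" "x i \<noteq> 0"
  shows "0 < ip x x"
  unfolding ip_def
proof (rule sum_pos2[of _ i])
  show "0 < w i * x i * x i"
    using assms w[of i] by (auto simp: mult.assoc zero_less_mult_iff linorder_neq_iff)
  show "0 \<le> w j * x j * x j" if "j \<in> {..<n}" for j
    using that w[of j] by (simp add: mult.assoc less_imp_le)
qed (use assms in auto)

lemma app_selfadjoint: "ip (app x) y = ip x (app y)"
proof -
  have "ip (app x) y = (\<Sum>i<n. \<Sum>k<n. w i * M $$ (i, k) * x k * y i)"
    by (simp add: ip_def app_def sum_distrib_left sum_distrib_right mult_ac)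
  also have "\<dots> = (\<Sum>i<n. \<Sum>k<n. w k * M $$ (k, i) * x k * y i)"
    using sym by (intro sum.cong) auto
  also have "\<dots> = (\<Sum>k<n. \<Sum>i<n. w k * M $$ (k, i) * x k * y i)"
    by (rule sum.swap)
  also have "\<dots> = ip x (app y)"
    by (simp add: ip_def app_def sum_distrib_left mult_ac)
  finally show ?thesis .
qed

lemma app_comb: "app (\<lambda>i. a * x i + b * y i) = (\<lambda>i. a * app x i + b * app y i)"
  by (rule ext) (simp add: app_def algebra_simps sum.distrib sum_distrib_left)

lemma spectrum_bounds:
  assumes upper: "\<And>x. (\<Sum>i<n. x i) = 0 \<Longrightarrow> ip (app x) x \<le> t * ip x x"
    and lower: "\<And>x. - t * ip x x \<le> ip (app x) x"
    and l: "1 \<le> l" "l < n"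
  shows "nth_eigenvalue (n - l) M \<le> t" "- t \<le> nth_eigenvalue l M"
proof -
  obtain es p q
    where es: "length es = n" "proots (char_poly M) = mset es"
      and ep: "\<forall>i<n. \<forall>j<n. (\<Sum>k<n. M $$ (i, k) * p k j) = es ! j * p i j"
      and qM: "\<forall>i<n. \<forall>j<n. (\<Sum>k<n. q i k * M $$ (k, j)) = es ! i * q i j"
      and qp: "\<forall>i<n. \<forall>j<n. (\<Sum>k<n. q i k * p k j) = (if i = j then 1 else 0)"
      and pq: "\<forall>i<n. \<forall>j<n. (\<Sum>k<n. p i k * q k j) = (if i = j then 1 else 0)"
    using diagonalization by blast
  define P where "P j i = p i j" for i j
  have eP: "app (P j) i = es ! j * P j i" if "i < n" "j < n" for i j
    using ep that by (simp add: P_def app_def)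
  have P0: "\<exists>i<n. P j i \<noteq> 0" if "j < n" for j
  proof (rule ccontr)
    assume "\<not> ?thesis"
    then have "(\<Sum>k<n. q j k * p k j) = 0" by (simp add: P_def)
    then show False using qp that by simp
  qed
  have ge: "- t \<le> es ! j" if "j < n" for j
  proof -
    have "ip (app (P j)) (P j) = ip (\<lambda>i. es ! j * P j i) (P j)"
      by (rule ip_cong) (auto simp: eP that)
    then have "- t * ip (P j) (P j) \<le> es ! j * ip (P j) (P j)"
      using lower[of "P j"] by (simp add: ip_scale_left)
    moreover have "0 < ip (P j) (P j)" using P0[OF that] ip_pos by blast
    ultimately show ?thesis by (meson mult_right_le_imp_le)
  qed
  have uniq: "i = j" if "i < n" "j < n" "t < es ! i" "t < es ! j" for i j
  proof (rule ccontr)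
    assume ne: "i \<noteq> j"
    define si where "si = (\<Sum>k<n. P i k)"
    define sj where "sj = (\<Sum>k<n. P j k)"
    define a where "a = (if sj = 0 \<and> si = 0 then 1 else sj)"
    define b where "b = - si"
    define x where "x = (\<lambda>k. a * P i k + b * P j k)"
    have ab: "a \<noteq> 0 \<or> b \<noteq> 0" by (auto simp: a_def b_def)
    have "(\<Sum>k<n. x k) = a * si + b * sj"
      by (simp add: x_def si_def sj_def sum.distrib sum_distrib_left)
    then have "(\<Sum>k<n. x k) = 0" by (auto simp: a_def b_def)
    from upper[OF this] have le: "ip (app x) x \<le> t * ip x x" .
    have qx: "(\<Sum>k<n. q i k * x k) = a" "(\<Sum>k<n. q j k * x k) = b"
    proof -
      have *: "(\<Sum>k<n. q r k * x k) = a * (\<Sum>k<n. q r k * p k i) + b * (\<Sum>k<n. q r k * p k j)" for r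
        by (simp add: x_def P_def algebra_simps sum.distrib sum_distrib_left)
      show "(\<Sum>k<n. q i k * x k) = a" "(\<Sum>k<n. q j k * x k) = b"
        using ne that by (auto simp: * qp)
    qed
    have "\<exists>k<n. x k \<noteq> 0"
    proof (rule ccontr)
      assume "\<not> ?thesis"
      then have "a = 0" "b = 0" using qx by auto
      with ab show False by simp
    qed
    then have pos: "0 < ip x x" using ip_pos by blast
    have selfadj: "(es ! i - es ! j) * ip (P i) (P j) = 0"
    proof -
      have "es ! i * ip (P i) (P j) = ip (app (P i)) (P j)"
        unfolding ip_scale_left[symmetric] by (rule ip_cong) (auto simp: eP that)
      also have "\<dots> = ip (P i) (app (P j))" by (rule app_selfadjoint)
      also have "\<dots> = es ! j * ip (P i) (P j)"
        unfolding ip_scale_right[symmetric] by (rule ip_cong) (auto simp: eP that)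
      finally show ?thesis by (simp add: algebra_simps)
    qed
    have xx: "ip x x = a\<^sup>2 * ip (P i) (P i) + 2 * (a * b) * ip (P i) (P j) + b\<^sup>2 * ip (P j) (P j)"
      by (simp add: x_def ip_add_left ip_scale_left ip_add_right ip_scale_right ip_commute[of "P j" "P i"]
          power2_eq_square algebra_simps)
    have "ip (app x) x = ip (\<lambda>k. a * (es ! i * P i k) + b * (es ! j * P j k)) x"
      by (rule ip_cong) (auto simp: x_def app_comb eP that)
    also have "\<dots> = es ! i * (a\<^sup>2 * ip (P i) (P i)) + es ! j * (b\<^sup>2 * ip (P j) (P j))
        + (es ! i + es ! j) * (a * b) * ip (P i) (P j)"
      by (simp add: x_def ip_add_left ip_scale_left ip_add_right ip_scale_right ip_commute[of "P j" "P i"]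
          power2_eq_square algebra_simps)
    finally have mxx: "ip (app x) x = es ! i * (a\<^sup>2 * ip (P i) (P i)) + es ! j * (b\<^sup>2 * ip (P j) (P j))
        + (es ! i + es ! j) * (a * b) * ip (P i) (P j)" .
    show False
    proof (cases "es ! i = es ! j")
      case True
      then have "ip (app x) x = es ! i * ip x x" unfolding mxx xx by (simp add: algebra_simps)
      with le pos that show False by (simp add: mult_le_cancel_right)
    next
      case False
      with selfadj have z: "ip (P i) (P j) = 0" by simp
      define u where "u = a\<^sup>2 * ip (P i) (P i)"
      define v where "v = b\<^sup>2 * ip (P j) (P j)"
      have uv: "0 \<le> u" "0 \<le> v" by (auto simp: u_def v_def ip_nonneg)
      have "(es ! i - t) * u + (es ! j - t) * v \<le> 0"
        using le z unfolding mxx xx u_def[symmetric] v_def[symmetric] by (simp add: algebra_simps)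
      moreover have "0 \<le> (es ! i - t) * u" "0 \<le> (es ! j - t) * v" using uv that by auto
      ultimately have "(es ! i - t) * u = 0" "(es ! j - t) * v = 0" by linarith+
      with that have "u = 0" "v = 0" by auto
      with pos z show False unfolding xx u_def[symmetric] v_def[symmetric] by simp
    qed
  qed
  have nth: "nth_eigenvalue i M = sort es ! (i - 1)" for i
    by (simp add: nth_eigenvalue_def es)
  have "card {j. j < n \<and> t < es ! j} \<le> 1"
  proof (rule ccontr)
    assume "\<not> ?thesis"
    then have "\<not> (\<forall>i\<in>{j. j < n \<and> t < es ! j}. \<forall>j\<in>{j. j < n \<and> t < es ! j}. i = j)"
      by (subst card_le_Suc0_iff_eq[symmetric]) auto
    then show False using uniq by blast
  qed
  moreover have "card {j. j < n \<and> t < es ! j} + card {j. j < n \<and> es ! j \<le> t} = n"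
  proof -
    have "{j. j < n \<and> t < es ! j} \<union> {j. j < n \<and> es ! j \<le> t} = {..<n}" by auto
    moreover have "card ({j. j < n \<and> t < es ! j} \<union> {j. j < n \<and> es ! j \<le> t})
        = card {j. j < n \<and> t < es ! j} + card {j. j < n \<and> es ! j \<le> t}"
      by (rule card_Un_disjoint) auto
    ultimately show ?thesis by simp
  qed
  ultimately have "n - l \<le> card {j. j < length es \<and> es ! j \<le> t}" using l es(1) by simp
  then show "nth_eigenvalue (n - l) M \<le> t"
    unfolding nth using l by (intro sorted_nth_le_if_card) auto
  have "sort es ! (l - 1) \<in> set es"
    using nth_mem[of "l - 1" "sort es"] l es(1) by simp
  then show "- t \<le> nth_eigenvalue l M"
    unfolding nth using ge es(1) by (metis in_set_conv_nth)
qed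

lemma eigenvalue_multiplicity_bounds:
  fixes g :: "'t \<Rightarrow> nat \<Rightarrow> real"
  assumes T: "finite T" "l + 2 \<le> card T"
    and ev: "\<And>\<alpha> i. (\<Sum>t\<in>T. \<alpha> t) = 0 \<Longrightarrow> i < n \<Longrightarrow>
      app (\<lambda>i. \<Sum>t\<in>T. \<alpha> t * g t i) i = \<theta> * (\<Sum>t\<in>T. \<alpha> t * g t i)"
    and indep: "\<And>\<alpha>. (\<forall>i<n. (\<Sum>t\<in>T. \<alpha> t * g t i) = 0) \<Longrightarrow> \<forall>t\<in>T. \<alpha> t = 0"
    and l: "1 \<le> l"
  shows "\<theta> \<le> nth_eigenvalue (n - l) M" "nth_eigenvalue l M \<le> \<theta>"
proof -
  obtain es p q
    where es: "length es = n" "proots (char_poly M) = mset es"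
      and ep: "\<forall>i<n. \<forall>j<n. (\<Sum>k<n. M $$ (i, k) * p k j) = es ! j * p i j"
      and qM: "\<forall>i<n. \<forall>j<n. (\<Sum>k<n. q i k * M $$ (k, j)) = es ! i * q i j"
      and qp: "\<forall>i<n. \<forall>j<n. (\<Sum>k<n. q i k * p k j) = (if i = j then 1 else 0)"
      and pq: "\<forall>i<n. \<forall>j<n. (\<Sum>k<n. p i k * q k j) = (if i = j then 1 else 0)"
    using diagonalization by blast
  define S where "S = {j. j < n \<and> es ! j = \<theta>}"
  have "l + 1 \<le> card S"
  proof (rule ccontr)
    assume "\<not> ?thesis"
    then have "card (insert None (Some ` S)) < card T"
      using T by (subst card_insert_disjoint) (auto simp: S_def card_image)
    from underdetermined_system[OF _ T(1) this,
        of "\<lambda>j t. case j of None \<Rightarrow> 1 | Some j \<Rightarrow> (\<Sum>k<n. q j k * g t k)"]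
    obtain \<alpha> where \<alpha>: "\<exists>t\<in>T. \<alpha> t \<noteq> 0" "(\<Sum>t\<in>T. \<alpha> t) = 0"
      and kill: "\<forall>j\<in>S. (\<Sum>t\<in>T. (\<Sum>k<n. q j k * g t k) * \<alpha> t) = 0"
      by (auto simp: S_def)
    define x where "x = (\<lambda>i. \<Sum>t\<in>T. \<alpha> t * g t i)"
    have qx: "(\<Sum>k<n. q j k * x k) = 0" if j: "j < n" for j
    proof (cases "j \<in> S")
      case True
      have "(\<Sum>k<n. q j k * x k) = (\<Sum>t\<in>T. (\<Sum>k<n. q j k * g t k) * \<alpha> t)"
        unfolding x_def sum_distrib_left sum_distrib_right
        by (subst sum.swap) (simp add: mult_ac)
      then show ?thesis using kill True by simp
    next
      case False
      have "\<theta> * (\<Sum>k<n. q j k * x k) = (\<Sum>k<n. q j k * app x k)"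
      proof -
        have "app x k = \<theta> * x k" if "k < n" for k
          using ev[OF \<alpha>(2) that] by (simp add: x_def)
        then show ?thesis by (simp add: sum_distrib_left mult_ac)
      qed
      also have "\<dots> = (\<Sum>i<n. (\<Sum>k<n. q j k * M $$ (k, i)) * x i)"
        unfolding app_def sum_distrib_left sum_distrib_right
        by (subst sum.swap) (simp add: mult_ac)
      also have "\<dots> = es ! j * (\<Sum>k<n. q j k * x k)"
        using qM j by (simp add: sum_distrib_left mult_ac)
      finally show ?thesis using False j by (auto simp: S_def)
    qed
    have x0: "x i = 0" if "i < n" for i
    proof -
      have "x i = (\<Sum>j<n. if i = j then x j else 0)" using that by simp
      also have "\<dots> = (\<Sum>j<n. (\<Sum>k<n. p i k * q k j) * x j)"
        using pq that by (intro sum.cong) auto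
      also have "\<dots> = (\<Sum>k<n. p i k * (\<Sum>j<n. q k j * x j))"
        unfolding sum_distrib_left sum_distrib_right
        by (subst sum.swap) (simp add: mult_ac)
      also have "\<dots> = 0" by (simp add: qx)
      finally show ?thesis .
    qed
    have "\<forall>t\<in>T. \<alpha> t = 0" by (rule indep) (use x0 in \<open>auto simp only: x_def\<close>)
    with \<alpha> show False by auto
  qed
  moreover have "card S \<le> card {j. j < length es \<and> \<theta> \<le> es ! j}"
    "card S \<le> card {j. j < length es \<and> es ! j \<le> \<theta>}"
    using es(1) by (auto intro!: card_mono simp: S_def)
  ultimately have 1: "l + 1 \<le> card {j. j < length es \<and> \<theta> \<le> es ! j}"
    and 2: "l \<le> card {j. j < length es \<and> es ! j \<le> \<theta>}" by auto
  have nth: "nth_eigenvalue i M = sort es ! (i - 1)" for i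
    by (simp add: nth_eigenvalue_def es)
  show "\<theta> \<le> nth_eigenvalue (n - l) M"
    using sorted_nth_ge_if_card[OF _ 1] es(1) by (simp add: nth)
  show "nth_eigenvalue l M \<le> \<theta>"
    using sorted_nth_le_if_card[OF l 2] by (simp add: nth)
qed

end

section \<open>Quadratic form of the adjacency matrix and isolated stars\<close>

definition adj :: "nat set set \<Rightarrow> nat \<Rightarrow> nat \<Rightarrow> real" where
  "adj E i j = (if {Suc i, Suc j} \<in> E then 1 else 0)"

definition weighted_degree :: "real \<Rightarrow> nat \<Rightarrow> nat set set \<Rightarrow> nat \<Rightarrow> real" where
  "weighted_degree c n E i = c + (\<Sum>j<n. adj E i j)"

lemma adj_commute: "adj E i j = adj E j i"
  by (simp add: adj_def insert_commute)

lemma weighted_degree_pos: "0 < c \<Longrightarrow> 0 < weighted_degree c n E i"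
  unfolding weighted_degree_def by (intro add_pos_nonneg sum_nonneg) (auto simp: adj_def)

lemma mat_inverse_diag:
  fixes f :: "nat \<Rightarrow> 'a::field"
  assumes f: "\<And>i. i < n \<Longrightarrow> f i \<noteq> 0"
  shows "mat_inverse (mat_diag n f) = Some (mat_diag n (\<lambda>i. inverse (f i)))"
proof -
  let ?D = "mat_diag n f" and ?D' = "mat_diag n (\<lambda>i. inverse (f i))"
  have D: "?D \<in> carrier_mat n n" "?D' \<in> carrier_mat n n" by (auto simp: mat_diag_def)
  have 1: "?D * ?D' = 1\<^sub>m n" "?D' * ?D = 1\<^sub>m n"
    using f by (auto simp: mat_diag_diag intro!: eq_matI) (auto simp: mat_diag_def)
  have "?D \<in> Units (ring_mat TYPE('a) n ())"
    unfolding Units_def ring_mat_def using D 1 by (auto simp del: mat_diag_diag intro!: bexI[of _ ?D'])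
  then obtain B where B: "mat_inverse ?D = Some B"
    using mat_inverse(1)[OF D(1), of "()"] by (cases "mat_inverse ?D") auto
  with mat_inverse(2)[OF D(1)] have DB: "?D * B = 1\<^sub>m n" "B \<in> carrier_mat n n" by auto
  have "B = (?D' * ?D) * B" using 1 DB by simp
  also have "\<dots> = ?D' * (?D * B)" using D DB by (intro assoc_mult_mat[of _ n n _ n _ n]) auto
  also have "\<dots> = ?D'" unfolding DB(1) by (rule right_mult_one_mat[OF D(2)])
  finally show ?thesis using B by simp
qed

lemma M_mat_eq:
  assumes "0 < c"
  shows "M_mat c n E = Matrix.mat n n (\<lambda>(i, j). (c / n + adj E i j) / weighted_degree c n E i)"
proof -
  have "D_mat c n E = mat_diag n (weighted_degree c n E)"
    by (auto simp: D_mat_def mat_diag_def weighted_degree_def adjacency_mat_def adj_def intro!: eq_matI sum.cong)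
  then have "mat_inverse (D_mat c n E) = Some (mat_diag n (\<lambda>i. inverse (weighted_degree c n E i)))"
    using weighted_degree_pos[OF assms] mat_inverse_diag[of n "weighted_degree c n E"] by (metis less_irrefl)
  moreover have X: "c \<cdot>\<^sub>m J_mat n + adjacency_mat n E \<in> carrier_mat n n"
    by (simp add: J_mat_def adjacency_mat_def)
  ultimately show ?thesis
    unfolding M_mat_def
    by (simp only: option.sel mat_diag_mult_left[OF X])
      (auto simp: J_mat_def adjacency_mat_def adj_def field_simps intro!: eq_matI)
qed

locale positive_parameter =
  fixes c :: real and n :: nat and E :: "nat set set"
  assumes c: "0 < c" and E: "E \<subseteq> vertex_pairs n"
begin

sublocale symmetrizable_matrix n "M_mat c n E" "weighted_degree c n E"
proof
  show "M_mat c n E \<in> carrier_mat n n" by (simp add: M_mat_eq[OF c])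
  show "0 < weighted_degree c n E i" for i by (rule weighted_degree_pos[OF c])
  show "weighted_degree c n E i * M_mat c n E $$ (i, j) = weighted_degree c n E j * M_mat c n E $$ (j, i)"
    if "i < n" "j < n" for i j
    using that weighted_degree_pos[OF c, of n E i] weighted_degree_pos[OF c, of n E j]
    by (simp add: M_mat_eq[OF c] adj_commute[of E j i])
qed

lemma app_eq: "i < n \<Longrightarrow> weighted_degree c n E i * app x i = c / n * (\<Sum>k<n. x k) + (\<Sum>k<n. adj E i k * x k)"
proof -
  assume i: "i < n"
  have "weighted_degree c n E i * app x i = (\<Sum>k<n. weighted_degree c n E i * (M_mat c n E $$ (i, k) * x k))"
    by (simp add: app_def sum_distrib_left)
  also have "\<dots> = (\<Sum>k<n. c / n * x k + adj E i k * x k)"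
    using i weighted_degree_pos[OF c, of n E i] by (intro sum.cong) (auto simp: M_mat_eq[OF c] field_simps)
  finally show ?thesis by (simp add: sum.distrib sum_distrib_left)
qed

lemma ip_app: "ip (app x) x = c / n * (\<Sum>i<n. x i)\<^sup>2 + (\<Sum>i<n. \<Sum>j<n. adj E i j * x i * x j)"
proof -
  have "ip (app x) x = (\<Sum>i<n. (weighted_degree c n E i * app x i) * x i)"
    by (simp add: ip_def)
  also have "\<dots> = (\<Sum>i<n. c / n * (\<Sum>k<n. x k) * x i + (\<Sum>j<n. adj E i j * x i * x j))"
    by (intro sum.cong) (auto simp: app_eq algebra_simps sum_distrib_left)
  also have "\<dots> = c / n * (\<Sum>k<n. x k) * (\<Sum>i<n. x i) + (\<Sum>i<n. \<Sum>j<n. adj E i j * x i * x j)"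
    by (simp add: sum.distrib sum_distrib_left)
  finally show ?thesis by (simp add: power2_eq_square)
qed

lemma adjacency_form_bound:
  fixes g :: "nat \<Rightarrow> nat \<Rightarrow> nat"
  assumes k: "1 \<le> k" and g: "\<And>e. e \<in> E \<Longrightarrow> \<exists>t<k. \<exists>v. e = {v, g t v}"
  shows "\<bar>\<Sum>i<n. \<Sum>j<n. adj E i j * x i * x j\<bar> \<le> tau (c / k) * ip x x"
proof -
  define s where "s = tau (c / k)"
  have cx: "0 < 1 + c / k" using c by (simp add: add_pos_nonneg)
  have s: "0 < s" "s \<le> 1" using c k cx by (auto simp: s_def tau_def)
  have s2: "1 / s = s * (1 + c / k)"
    using cx by (simp add: s_def tau_def real_div_sqrt)
  define out where "out i j \<longleftrightarrow> (\<exists>t<k. Suc j = g t (Suc i))" for i j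
  define R where "R i j = (if {Suc i, Suc j} \<in> E \<and> out i j \<and> \<not> (j < i \<and> out j i) then 1 else 0 :: real)" for i j
  have AR: "adj E i j = R i j + R j i" for i j
  proof (cases "{Suc i, Suc j} \<in> E")
    case True
    then have "i \<noteq> j" using E by (auto simp: vertex_pairs_def)
    moreover have "out i j \<or> out j i"
      using g[OF True] by (auto simp: out_def doubleton_eq_iff)
    ultimately show ?thesis using True by (auto simp: adj_def R_def insert_commute)
  next
    case False
    then show ?thesis by (auto simp: adj_def R_def insert_commute)
  qed
  have R0: "0 \<le> R i j" for i j by (simp add: R_def)
  have outdeg: "(\<Sum>j<n. R i j) \<le> k" for i
  proof -
    have "(\<Sum>j<n. R i j) \<le> (\<Sum>j<n. if out i j then 1 else 0)"
      by (rule sum_mono) (auto simp: R_def)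
    also have "\<dots> = card {j. j < n \<and> out i j}"
      by (simp add: sum.If_cases Int_def)
    also have "card {j. j < n \<and> out i j} \<le> card ((\<lambda>t. g t (Suc i) - 1) ` {..<k})"
    proof (rule card_mono, simp, rule subsetI)
      fix j assume "j \<in> {j. j < n \<and> out i j}"
      then obtain t where "t < k" "Suc j = g t (Suc i)" by (auto simp: out_def)
      then show "j \<in> (\<lambda>t. g t (Suc i) - 1) ` {..<k}" by (intro image_eqI[of _ _ t]) (auto dest: sym)
    qed
    also have "\<dots> \<le> k" using card_image_le[of "{..<k}" "\<lambda>t. g t (Suc i) - 1"] by simp
    finally show ?thesis by simp
  qed
  define o_deg where "o_deg i = (\<Sum>j<n. R i j)" for i
  define i_deg where "i_deg i = (\<Sum>j<n. R j i)" for i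
  have deg: "weighted_degree c n E i = c + o_deg i + i_deg i" for i
    by (simp add: weighted_degree_def AR o_deg_def i_deg_def sum.distrib)
  have amgm: "2 * (\<bar>x i\<bar> * \<bar>x j\<bar>) \<le> (x i)\<^sup>2 / s + s * (x j)\<^sup>2" for i j
  proof -
    have "0 \<le> (\<bar>x i\<bar> - s * \<bar>x j\<bar>)\<^sup>2 / s" using s by simp
    also have "\<dots> = (x i)\<^sup>2 / s + s * (x j)\<^sup>2 - 2 * (\<bar>x i\<bar> * \<bar>x j\<bar>)"
      using s by (simp add: power2_diff field_simps power2_eq_square)
    finally show ?thesis by simp
  qed
  have "\<bar>\<Sum>i<n. \<Sum>j<n. adj E i j * x i * x j\<bar> \<le> (\<Sum>i<n. \<Sum>j<n. \<bar>adj E i j * x i * x j\<bar>)"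
    by (rule order_trans[OF sum_abs sum_mono[OF sum_abs]])
  also have "\<dots> = (\<Sum>i<n. \<Sum>j<n. R i j * (\<bar>x i\<bar> * \<bar>x j\<bar>)) + (\<Sum>i<n. \<Sum>j<n. R j i * (\<bar>x i\<bar> * \<bar>x j\<bar>))"
  proof -
    have "\<bar>adj E i j * x i * x j\<bar> = R i j * (\<bar>x i\<bar> * \<bar>x j\<bar>) + R j i * (\<bar>x i\<bar> * \<bar>x j\<bar>)" for i j
    proof -
      have "\<bar>adj E i j\<bar> = R i j + R j i" using R0 by (simp add: AR)
      then show ?thesis by (simp add: abs_mult algebra_simps)
    qed
    then show ?thesis by (simp add: sum.distrib)
  qed
  also have "(\<Sum>i<n. \<Sum>j<n. R j i * (\<bar>x i\<bar> * \<bar>x j\<bar>)) = (\<Sum>i<n. \<Sum>j<n. R i j * (\<bar>x i\<bar> * \<bar>x j\<bar>))"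
    by (subst sum.swap) (simp add: mult_ac)
  also have "(\<Sum>i<n. \<Sum>j<n. R i j * (\<bar>x i\<bar> * \<bar>x j\<bar>)) + (\<Sum>i<n. \<Sum>j<n. R i j * (\<bar>x i\<bar> * \<bar>x j\<bar>))
      = (\<Sum>i<n. \<Sum>j<n. R i j * (2 * (\<bar>x i\<bar> * \<bar>x j\<bar>)))"
    by (simp add: sum.distrib[symmetric] mult_ac)
  also have "\<dots> \<le> (\<Sum>i<n. \<Sum>j<n. R i j * ((x i)\<^sup>2 / s + s * (x j)\<^sup>2))"
    by (intro sum_mono mult_left_mono amgm R0)
  also have "\<dots> = (\<Sum>i<n. \<Sum>j<n. R i j * (x i)\<^sup>2 / s) + (\<Sum>i<n. \<Sum>j<n. s * R i j * (x j)\<^sup>2)"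
    by (simp add: algebra_simps sum.distrib)
  also have "(\<Sum>i<n. \<Sum>j<n. s * R i j * (x j)\<^sup>2) = (\<Sum>j<n. s * i_deg j * (x j)\<^sup>2)"
    by (subst sum.swap) (simp add: i_deg_def sum_distrib_left sum_distrib_right)
  also have "(\<Sum>i<n. \<Sum>j<n. R i j * (x i)\<^sup>2 / s) = (\<Sum>i<n. o_deg i * (1 / s) * (x i)\<^sup>2)"
    by (simp add: o_deg_def sum_distrib_left sum_distrib_right sum_divide_distrib)
  also have "(\<Sum>i<n. o_deg i * (1 / s) * (x i)\<^sup>2) + (\<Sum>j<n. s * i_deg j * (x j)\<^sup>2)
      = (\<Sum>i<n. (o_deg i * (1 / s) + s * i_deg i) * (x i)\<^sup>2)"
    by (simp add: algebra_simps sum.distrib)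
  also have "\<dots> \<le> (\<Sum>i<n. s * weighted_degree c n E i * (x i)\<^sup>2)"
  proof (intro sum_mono mult_right_mono)
    fix i
    have "o_deg i * c / k \<le> c"
      using outdeg[of i] c k by (simp add: o_deg_def field_simps)
    then have "s * (o_deg i * c / k) \<le> s * c" using s by (intro mult_left_mono) auto
    then show "o_deg i * (1 / s) + s * i_deg i \<le> s * weighted_degree c n E i"
      unfolding s2 deg by (simp add: algebra_simps)
  qed simp
  also have "\<dots> = s * ip x x"
    by (simp add: ip_def sum_distrib_left power2_eq_square mult_ac)
  finally show ?thesis by (simp add: s_def)
qed

lemma orientable_spectrum_bounds:
  fixes g :: "nat \<Rightarrow> nat \<Rightarrow> nat"
  assumes k: "1 \<le> k" and g: "\<And>e. e \<in> E \<Longrightarrow> \<exists>t<k. \<exists>v. e = {v, g t v}"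
    and "1 \<le> l" "l < n"
  shows "nth_eigenvalue (n - l) (M_mat c n E) \<le> tau (c / k)"
    "- tau (c / k) \<le> nth_eigenvalue l (M_mat c n E)"
proof -
  note form = adjacency_form_bound[OF k g]
  have u: "ip (app x) x \<le> tau (c / k) * ip x x" if "(\<Sum>i<n. x i) = 0" for x
    using form[of x] that by (simp add: ip_app)
  have l: "- tau (c / k) * ip x x \<le> ip (app x) x" for x
  proof -
    have "0 \<le> c / n * (\<Sum>i<n. x i)\<^sup>2" using c by simp
    with form[of x] show ?thesis by (simp add: ip_app)
  qed
  show "nth_eigenvalue (n - l) (M_mat c n E) \<le> tau (c / k)"
    "- tau (c / k) \<le> nth_eigenvalue l (M_mat c n E)"
    using spectrum_bounds[OF u l assms(3,4)] by auto
qed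

end

definition isolated_star :: "nat set set \<Rightarrow> nat \<times> nat set \<Rightarrow> bool" where
  "isolated_star E = (\<lambda>(u, L). u \<notin> L \<and> (\<forall>v. {u, v} \<in> E \<longleftrightarrow> v \<in> L) \<and>
     (\<forall>x\<in>L. \<forall>v. {x, v} \<in> E \<longleftrightarrow> v = u))"

lemma isolated_stars_disjoint:
  assumes 1: "isolated_star E (u, L)" and 2: "isolated_star E (u', L')"
    and L: "2 \<le> card L" "2 \<le> card L'"
    and ne: "(u, L) \<noteq> (u', L')"
  shows "insert u L \<inter> insert u' L' = {}"
proof -
  have not_single: "L \<noteq> {a}" "L' \<noteq> {a}" for a using L by auto
  have N: "\<And>v. {u, v} \<in> E \<longleftrightarrow> v \<in> L" "\<And>x v. x \<in> L \<Longrightarrow> {x, v} \<in> E \<longleftrightarrow> v = u"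
    "\<And>v. {u', v} \<in> E \<longleftrightarrow> v \<in> L'" "\<And>x v. x \<in> L' \<Longrightarrow> {x, v} \<in> E \<longleftrightarrow> v = u'"
    using 1 2 by (auto simp: isolated_star_def)
  have "u \<noteq> u'"
  proof
    assume "u = u'"
    with N have "L = L'" by auto
    with \<open>u = u'\<close> ne show False by simp
  qed
  moreover have "u \<notin> L'"
  proof
    assume "u \<in> L'"
    then have "L = {u'}" using N(1) N(4)[of u] by auto
    with not_single show False by blast
  qed
  moreover have "u' \<notin> L"
  proof
    assume "u' \<in> L"
    then have "L' = {u}" using N(3) N(2)[of u'] by auto
    with not_single show False by blast
  qed
  moreover have "L \<inter> L' = {}"
    using N(2,4) \<open>u \<noteq> u'\<close> by auto
  ultimately show ?thesis by auto
qed

context positive_parameter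
begin

lemma isolated_stars_spectrum_bounds:
  assumes T: "finite T" "l + 2 \<le> card T"
    and star: "\<And>t. t \<in> T \<Longrightarrow> isolated_star E t \<and> card (snd t) = m"
    and m: "2 \<le> m" and l: "1 \<le> l"
    and \<theta>: "\<theta> * \<theta> * (1 + c) * (m + c) = m" and "\<theta> \<noteq> 0"
  shows "\<theta> \<le> nth_eigenvalue (n - l) (M_mat c n E)" "nth_eigenvalue l (M_mat c n E) \<le> \<theta>"
proof -
  define g where "g = (\<lambda>(u, L) i. if Suc i = u then \<theta> * (1 + c) else if Suc i \<in> L then 1 else 0)"
  have range: "v \<in> {1..n}" if "{u, v} \<in> E" for u v
    using that E by (auto simp: vertex_pairs_def)
  have leaves: "L \<subseteq> Suc ` {..<n}" "u \<in> Suc ` {..<n}" "u \<notin> L" if "(u, L) \<in> T" for u L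
  proof -
    have st: "isolated_star E (u, L)" "card L = m" using star[OF that] by auto
    have "v \<in> {1..n}" if "v \<in> L" for v
      using range[of u v] st(1) that by (auto simp: isolated_star_def)
    then show "L \<subseteq> Suc ` {..<n}" by (auto simp: image_iff Bex_def) (metis Suc_le_lessD Suc_pred)
    from st(2) m have "L \<noteq> {}" by auto
    then obtain x where "x \<in> L" by auto
    then have "u \<in> {1..n}" using range[of x u] st(1) by (auto simp: isolated_star_def)
    then show "u \<in> Suc ` {..<n}" by (auto simp: image_iff Bex_def) (metis Suc_le_lessD Suc_pred)
    show "u \<notin> L" using st by (simp add: isolated_star_def)
  qed
  have sumL: "(\<Sum>k<n. if Suc k \<in> L then 1 else 0 :: real) = m" if "(u, L) \<in> T" for u L
  proof -
    have "(\<Sum>k<n. if Suc k \<in> L then 1 else 0 :: real) = card {k. k < n \<and> Suc k \<in> L}"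
      by (simp add: sum.If_cases Int_def)
    also have "card {k. k < n \<and> Suc k \<in> L} = card (Suc ` {k. k < n \<and> Suc k \<in> L})"
      by (simp add: card_image)
    also have "Suc ` {k. k < n \<and> Suc k \<in> L} = L" using leaves[OF that] by auto
    finally show ?thesis using star[OF that] by simp
  qed
  have sumu: "(\<Sum>k<n. if Suc k = u then a else 0 :: real) = a" if "(u, L) \<in> T" for u L a
  proof -
    have "u \<in> Suc ` {..<n}" by (rule leaves(2)[OF that])
    then obtain r where "r < n" "u = Suc r" by auto
    then show ?thesis by simp
  qed
  have sumg: "(\<Sum>k<n. g t k) = \<theta> * (1 + c) + m" if "t \<in> T" for t
  proof -
    obtain u L where t: "t = (u, L)" by force
    have "(\<Sum>k<n. g t k) = (\<Sum>k<n. (if Suc k = u then \<theta> * (1 + c) else 0) + (if Suc k \<in> L then 1 else 0))"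
      using leaves(3)[of u L] that by (intro sum.cong) (auto simp: g_def t)
    then show ?thesis using sumL[of u L] sumu[of u L] that by (simp add: sum.distrib t)
  qed
  have eig: "(\<Sum>k<n. adj E i k * g t k) = \<theta> * weighted_degree c n E i * g t i" if "t \<in> T" "i < n" for t i
  proof -
    obtain u L where t: "t = (u, L)" by force
    have st: "\<And>v. {u, v} \<in> E \<longleftrightarrow> v \<in> L" "\<And>x v. x \<in> L \<Longrightarrow> {x, v} \<in> E \<longleftrightarrow> v = u" "u \<notin> L"
      using star[OF that(1)] by (auto simp: t isolated_star_def)
    have uL: "(u, L) \<in> T" using that t by simp
    consider "Suc i = u" | "Suc i \<in> L" | "Suc i \<noteq> u" "Suc i \<notin> L" by blast
    then show ?thesis
    proof cases
      case 1
      have a: "adj E i k = (if Suc k \<in> L then 1 else 0)" for k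
        using st 1 by (simp add: adj_def)
      have d: "weighted_degree c n E i = c + m" unfolding weighted_degree_def a using sumL[OF uL] by simp
      have "(\<Sum>k<n. adj E i k * g t k) = (\<Sum>k<n. if Suc k \<in> L then 1 else 0)"
        using st(3) by (intro sum.cong) (auto simp: a g_def t)
      also have "\<dots> = \<theta> * weighted_degree c n E i * g t i"
        using sumL[OF uL] 1 \<theta> by (simp add: g_def t d algebra_simps)
      finally show ?thesis .
    next
      case 2
      then have a: "adj E i k = (if Suc k = u then 1 else 0)" for k
        using st by (simp add: adj_def)
      have d: "weighted_degree c n E i = c + 1" unfolding weighted_degree_def a using sumu[OF uL] by simp
      have "(\<Sum>k<n. adj E i k * g t k) = (\<Sum>k<n. if Suc k = u then \<theta> * (1 + c) else 0)"
        by (intro sum.cong) (auto simp: a g_def t)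
      also have "\<dots> = \<theta> * weighted_degree c n E i * g t i"
        using sumu[OF uL] 2 st(3) by (auto simp: g_def t d algebra_simps)
      finally show ?thesis .
    next
      case 3
      have "adj E i k * g t k = 0" for k
        using 3 st(1)[of "Suc i"] st(2)[of "Suc k" "Suc i"]
        by (auto simp: adj_def g_def t insert_commute)
      then show ?thesis using 3 by (simp add: g_def t)
    qed
  qed
  have ev: "app (\<lambda>i. \<Sum>t\<in>T. \<alpha> t * g t i) i = \<theta> * (\<Sum>t\<in>T. \<alpha> t * g t i)"
    if "(\<Sum>t\<in>T. \<alpha> t) = 0" "i < n" for \<alpha> i
  proof -
    let ?x = "\<lambda>i. \<Sum>t\<in>T. \<alpha> t * g t i"
    have "(\<Sum>k<n. ?x k) = (\<Sum>t\<in>T. \<alpha> t * (\<Sum>k<n. g t k))"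
      by (subst sum.swap) (simp add: sum_distrib_left)
    also have "\<dots> = (\<Sum>t\<in>T. \<alpha> t) * (\<theta> * (1 + c) + m)"
      by (simp add: sumg sum_distrib_right)
    finally have "(\<Sum>k<n. ?x k) = 0" by (simp only: that mult_zero_left)
    moreover have "(\<Sum>k<n. adj E i k * ?x k) = \<theta> * weighted_degree c n E i * ?x i"
    proof -
      have "(\<Sum>k<n. adj E i k * ?x k) = (\<Sum>t\<in>T. \<alpha> t * (\<Sum>k<n. adj E i k * g t k))"
        unfolding sum_distrib_left by (subst sum.swap) (simp add: mult_ac)
      also have "\<dots> = (\<Sum>t\<in>T. \<alpha> t * (\<theta> * weighted_degree c n E i * g t i))"
        using eig that by (intro sum.cong) auto
      finally show ?thesis by (simp add: sum_distrib_left mult_ac)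
    qed
    ultimately have "weighted_degree c n E i * app ?x i = weighted_degree c n E i * (\<theta> * ?x i)"
      using app_eq[OF that(2), of ?x] by simp
    then show ?thesis using weighted_degree_pos[OF c, of n E i] by simp
  qed
  have indep: "\<forall>t\<in>T. \<alpha> t = 0" if "\<forall>i<n. (\<Sum>t\<in>T. \<alpha> t * g t i) = 0" for \<alpha>
  proof
    fix t assume tT: "t \<in> T"
    obtain u L where t: "t = (u, L)" by force
    with leaves[of u L] tT obtain r where r: "r < n" "u = Suc r" by auto
    have "\<alpha> t' * g t' r = (if t' = t then \<alpha> t * (\<theta> * (1 + c)) else 0)" if t': "t' \<in> T" for t'
    proof (cases "t' = t")
      case True
      then show ?thesis by (simp add: g_def t r)
    next
      case False
      obtain u' L' where t'': "t' = (u', L')" by force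
      have "insert u L \<inter> insert u' L' = {}"
        using star[OF tT] star[OF t'] False m by (intro isolated_stars_disjoint) (auto simp: t t'')
      then show ?thesis using False by (auto simp: g_def t'' r)
    qed
    then have "(\<Sum>t'\<in>T. \<alpha> t' * g t' r) = \<alpha> t * (\<theta> * (1 + c))"
      using tT T(1) by simp
    with that r have "\<alpha> t * (\<theta> * (1 + c)) = 0" by auto
    then show "\<alpha> t = 0" using \<open>\<theta> \<noteq> 0\<close> c by simp
  qed
  show "\<theta> \<le> nth_eigenvalue (n - l) (M_mat c n E)" "nth_eigenvalue l (M_mat c n E) \<le> \<theta>"
    using eigenvalue_multiplicity_bounds[OF T, of g \<theta>, OF ev indep l] by auto
qed

end

section \<open>Pseudoforests\<close>

fun path_edges :: "'a list \<Rightarrow> 'a set set" where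
  "path_edges (x # y # zs) = insert {x, y} (path_edges (y # zs))"
| "path_edges _ = {}"

lemma path_edges_subset: "e \<in> path_edges vs \<Longrightarrow> e \<subseteq> set vs"
  by (induction vs rule: path_edges.induct) auto

lemma finite_path_edges [simp]: "finite (path_edges vs)"
  by (induction vs rule: path_edges.induct) auto

lemma path_edges_Cons: "vs \<noteq> [] \<Longrightarrow> path_edges (x # vs) = insert {x, hd vs} (path_edges vs)"
  by (cases vs) auto

lemma path_edges_append:
  "xs \<noteq> [] \<Longrightarrow> ys \<noteq> [] \<Longrightarrow>
    path_edges (xs @ ys) = insert {last xs, hd ys} (path_edges xs \<union> path_edges ys)"
proof (induction xs rule: path_edges.induct)
  case ("2_2" v)
  then show ?case by (simp add: path_edges_Cons)
qed (simp_all add: insert_commute)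

lemma path_edges_rev: "path_edges (rev vs) = path_edges vs"
proof (induction vs)
  case (Cons x vs)
  then show ?case
    by (cases "vs = []") (auto simp: path_edges_append path_edges_Cons last_rev insert_commute)
qed simp

lemma card_path_edges: "distinct vs \<Longrightarrow> card (path_edges vs) = length vs - 1"
proof (induction vs rule: path_edges.induct)
  case (1 x y zs)
  then have "{x, y} \<notin> path_edges (y # zs)" using path_edges_subset[of "{x, y}" "y # zs"] by auto
  with 1 show ?case by simp
qed auto

definition chorded_path :: "'a set set \<Rightarrow> 'a list \<Rightarrow> 'a set \<Rightarrow> 'a set \<Rightarrow> bool" where
  "chorded_path E vs e1 e2 \<longleftrightarrow> distinct vs \<and> path_edges vs \<subseteq> E \<and> e1 \<in> E - path_edges vs \<and>
     e2 \<in> E - path_edges vs \<and> e1 \<noteq> e2 \<and> e1 \<subseteq> set vs \<and> e2 \<subseteq> set vs"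

lemma path_edges_orientation:
  assumes "distinct vs" "vs \<noteq> []"
  shows "\<exists>h. h (last vs) = a \<and> (\<forall>e\<in>path_edges vs. \<exists>v\<in>set vs. e = {v, h v})"
  using assms
proof (induction vs rule: path_edges.induct)
  case (1 x y zs)
  then obtain h where h: "h (last (y # zs)) = a" "\<forall>e\<in>path_edges (y # zs). \<exists>v\<in>set (y # zs). e = {v, h v}"
    by auto
  have "x \<noteq> last (y # zs)" using 1 last_in_set[of "y # zs"] by auto
  then have "(h(x := y)) (last (x # y # zs)) = a" using h(1) by simp
  moreover have "\<exists>v\<in>set (x # y # zs). e = {v, (h(x := y)) v}" if "e \<in> path_edges (x # y # zs)" for e
  proof (cases "e = {x, y}")
    case True
    then show ?thesis by auto
  next
    case False
    with that h(2) obtain v where "v \<in> set (y # zs)" "e = {v, h v}" by auto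
    then show ?thesis using 1 by (intro bexI[of _ v]) auto
  qed
  ultimately show ?case by blast
next
  case ("2_2" v)
  then show ?case by (intro exI[of _ "\<lambda>_. a"]) simp
qed simp

lemma longest_path_end_chord:
  assumes E: "\<And>e. e \<in> E \<Longrightarrow> card e = 2"
    and vs: "distinct vs" "path_edges vs \<subseteq> E" "2 \<le> length vs"
    and max: "\<And>y. y \<notin> set vs \<Longrightarrow> {y, hd vs} \<notin> E"
    and no_leaf: "\<And>v e. e \<in> E \<Longrightarrow> v \<in> e \<Longrightarrow> \<exists>e'\<in>E. v \<in> e' \<and> e' \<noteq> e"
  shows "\<exists>e\<in>E - path_edges vs. hd vs \<in> e \<and> e \<subseteq> set vs"
proof -
  obtain a b zs where eq: "vs = a # b # zs"
    using vs(3) by (metis One_nat_def Suc_1 Suc_le_length_iff)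
  then obtain e where e: "e \<in> E" "a \<in> e" "e \<noteq> {a, b}" using no_leaf[of "{a, b}" a] vs by auto
  with E[OF e(1)] obtain y where y: "e = {a, y}"
    by (auto simp: card_2_iff)
  with max[of y] e(1) have "y \<in> set vs" by (auto simp: eq insert_commute)
  moreover have "e \<notin> path_edges vs"
    using path_edges_subset[of e "b # zs"] e vs by (auto simp: eq)
  ultimately show ?thesis using e y by (intro bexI[of _ e]) (auto simp: eq)
qed

text \<open>Leaves can be stripped off.  Without leaves, the two ends of a longest path each carry a
  further edge back into the path; these two edges must coincide, so that the path closes up to a
  cycle, and this cycle is then a whole component.\<close>

lemma pseudoforest_orientation:
  assumes "finite E" "\<And>e. e \<in> E \<Longrightarrow> card e = 2" "\<And>vs e1 e2. \<not> chorded_path E vs e1 e2"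
  shows "\<exists>f. \<forall>e\<in>E. \<exists>v. e = {v, f v}"
  using assms
proof (induction E rule: finite_psubset_induct)
  case (psubset E)
  have IH: "\<exists>f. \<forall>e\<in>E'. \<exists>v. e = {v, f v}" if "E' \<subset> E" for E'
  proof (rule psubset.IH[OF that])
    show "\<not> chorded_path E' vs e1 e2" for vs e1 e2
    proof
      assume "chorded_path E' vs e1 e2"
      then have "chorded_path E vs e1 e2" using that unfolding chorded_path_def by auto
      with psubset.prems(2) show False by blast
    qed
  qed (use psubset.prems(1) that in auto)
  show ?case
  proof (cases "\<exists>e\<in>E. \<exists>v\<in>e. \<forall>e'\<in>E. v \<in> e' \<longrightarrow> e' = e")
    case True
    then obtain e v where e: "e \<in> E" "v \<in> e" "\<And>e'. e' \<in> E \<Longrightarrow> v \<in> e' \<Longrightarrow> e' = e" by blast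
    obtain f where f: "\<forall>e'\<in>E - {e}. \<exists>v. e' = {v, f v}"
      using IH[of "E - {e}"] e(1) by blast
    obtain u where u: "e = {v, u}"
      using psubset.prems(1)[OF e(1)] e(2) by (auto simp: card_2_iff)
    have "\<exists>x. e' = {x, (f(v := u)) x}" if e'E: "e' \<in> E" for e'
    proof (cases "e' = e")
      case True
      then show ?thesis using u by (intro exI[of _ v]) simp
    next
      case False
      with f e'E obtain x where "e' = {x, f x}" by auto
      moreover have "v \<notin> e'" using e(3) that False by auto
      ultimately show ?thesis by (intro exI[of _ x]) auto
    qed
    then show ?thesis by (intro exI[of _ "f(v := u)"]) auto
  next
    case no_leaf: False
    show ?thesis
    proof (cases "E = {}")
      case True
      then show ?thesis by simp
    next
      case False
      have finU: "finite (\<Union>E)"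
        using psubset.hyps psubset.prems(1) by (auto simp: card_2_iff)
      define paths where "paths vs \<longleftrightarrow> distinct vs \<and> path_edges vs \<subseteq> E \<and> set vs \<subseteq> \<Union>E" for vs
      obtain e0 where "e0 \<in> E" using False by auto
      then obtain a0 b0 where ab: "{a0, b0} \<in> E" "a0 \<noteq> b0"
        using psubset.prems(1)[of e0] by (auto simp: card_2_iff)
      then have p0: "paths [a0, b0]" by (auto simp: paths_def)
      have bound: "length vs < Suc (card (\<Union>E))" if "paths vs" for vs
      proof -
        have "length vs = card (set vs)" using that by (simp add: paths_def distinct_card)
        also have "\<dots> \<le> card (\<Union>E)" using that finU by (intro card_mono) (auto simp: paths_def)
        finally show ?thesis by simp
      qed
      have "\<exists>vs. paths vs \<and> (\<forall>ws. paths ws \<longrightarrow> length ws \<le> length vs)"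
        using p0 bound by (intro ex_has_greatest_nat[of paths _ length]) auto
      then obtain vs where vs: "paths vs" and max: "\<And>ws. paths ws \<Longrightarrow> length ws \<le> length vs"
        by blast
      from max[OF p0] have len: "2 \<le> length vs" by simp
      then have ne: "vs \<noteq> []" by auto
      have no_ext: "{y, hd ws} \<notin> E"
        if "set ws = set vs" "distinct ws" "path_edges ws \<subseteq> E" "y \<notin> set vs" for y ws
      proof
        assume yE: "{y, hd ws} \<in> E"
        have "ws \<noteq> []" using that ne by auto
        then have "paths (y # ws)"
          using yE that vs by (auto simp: paths_def path_edges_Cons)
        moreover have "length ws = length vs" using that vs
          by (metis distinct_card paths_def)
        ultimately show False using max[of "y # ws"] by simp
      qed
      have nl: "\<exists>e'\<in>E. v \<in> e' \<and> e' \<noteq> e" if "e \<in> E" "v \<in> e" for v e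
        using no_leaf that by blast
      have vsd: "distinct vs" "path_edges vs \<subseteq> E" using vs by (auto simp: paths_def)
      obtain e1 where e1: "e1 \<in> E - path_edges vs" "hd vs \<in> e1" "e1 \<subseteq> set vs"
        using longest_path_end_chord[OF psubset.prems(1) vsd len no_ext[OF refl vsd] nl] by blast
      have rv: "distinct (rev vs)" "path_edges (rev vs) \<subseteq> E" "2 \<le> length (rev vs)"
        using vsd len by (auto simp: path_edges_rev)
      have "y \<notin> set (rev vs) \<Longrightarrow> {y, hd (rev vs)} \<notin> E" for y
        using no_ext[of "rev vs" y] rv by simp
      from longest_path_end_chord[OF psubset.prems(1) rv this nl]
      obtain e2 where e2: "e2 \<in> E - path_edges vs" "last vs \<in> e2" "e2 \<subseteq> set vs"
        by (auto simp: path_edges_rev hd_rev)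
      have "e1 = e2"
        using psubset.prems(2)[of vs e1 e2] e1 e2 vsd by (auto simp: chorded_path_def)
      moreover have "hd vs \<noteq> last vs"
        using vsd(1) len by (cases vs) auto
      ultimately have e1eq: "e1 = {last vs, hd vs}"
        using psubset.prems(1)[of e1] e1 e2 by (auto simp: card_2_iff)
      define C where "C = insert e1 (path_edges vs)"
      have cyc: "e \<in> C" if xe: "e \<in> E" "x \<in> e" "x \<in> set vs" for e x
      proof (rule ccontr)
        assume eC: "e \<notin> C"
        show False
        proof (cases "e \<subseteq> set vs")
          case True
          then show False
            using psubset.prems(2)[of vs e1 e] eC that e1 vsd by (auto simp: chorded_path_def C_def)
        next
          case False
          then obtain y where y: "e = {y, x}" "y \<notin> set vs"
            using psubset.prems(1)[OF xe(1)] xe by (auto simp: card_2_iff)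
          obtain xs ys where split: "vs = xs @ x # ys" using xe(3) by (meson split_list)
          have "path_edges ((x # ys) @ xs) \<subseteq> E"
          proof (cases "xs = []")
            case True
            then show ?thesis using vsd split by simp
          next
            case False
            then have "path_edges ((x # ys) @ xs) =
                insert {last vs, hd vs} (path_edges (x # ys) \<union> path_edges xs)"
              by (subst path_edges_append) (auto simp: split)
            also have "\<dots> \<subseteq> insert e1 (path_edges vs)"
              using False by (auto simp: split path_edges_append e1eq)
            finally show ?thesis using vsd e1 by auto
          qed
          with no_ext[of "(x # ys) @ xs" y] y that(1) vsd(1) show False
            by (auto simp: split)
        qed
      qed
      obtain h where h: "h (last vs) = hd vs" "\<forall>e\<in>path_edges vs. \<exists>v\<in>set vs. e = {v, h v}"
        using path_edges_orientation[OF vsd(1) ne] by blast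
      obtain f where f: "\<forall>e\<in>E - C. \<exists>v. e = {v, f v}"
        using IH[of "E - C"] e1(1) unfolding C_def by blast
      define f' where "f' v = (if v \<in> set vs then h v else f v)" for v
      have "\<exists>v. e = {v, f' v}" if eE: "e \<in> E" for e
      proof (cases "e \<in> C")
        case True
        then consider "e = e1" | "e \<in> path_edges vs" by (auto simp: C_def)
        then show ?thesis
        proof cases
          case 1
          then show ?thesis using h(1) ne by (intro exI[of _ "last vs"]) (auto simp: f'_def e1eq)
        next
          case 2
          then obtain v where "v \<in> set vs" "e = {v, h v}" using h(2) by auto
          then show ?thesis by (intro exI[of _ v]) (auto simp: f'_def)
        qed
      next
        case False
        with f eE obtain v where v: "e = {v, f v}" by auto
        have "v \<notin> set vs" using cyc[OF that, of v] False v by auto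
        then show ?thesis using v by (intro exI[of _ v]) (auto simp: f'_def)
      qed
      then show ?thesis by auto
    qed
  qed
qed

section \<open>Orientability of the random graph\<close>

lemma finite_vertex_pairs [simp]: "finite (vertex_pairs n)"
  unfolding vertex_pairs_def by (rule finite_subset[of _ "Pow {1..n}"]) auto

lemma set_pmf_random_graph: "set_pmf (random_graph n a) \<subseteq> Pow (vertex_pairs n)"
  by (auto simp: random_graph_def)

lemma prob_random_graph_Int:
  assumes a: "0 \<le> a" "a \<le> 1" and FW: "F \<subseteq> W" "W \<subseteq> vertex_pairs n"
  shows "measure_pmf.prob (random_graph n a) {E. E \<inter> W = F} = a ^ card F * (1 - a) ^ (card W - card F)"
proof -
  let ?V = "vertex_pairs n"
  have finW: "finite W" by (rule finite_subset[OF FW(2) finite_vertex_pairs])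
  then have fin: "finite W" "finite F" using finite_subset[OF FW(1)] by auto
  define B where "B e = (if e \<in> W then {e \<in> F} else UNIV)" for e
  have *: "prod h ?V = prod h W" if "\<And>e. e \<in> ?V - W \<Longrightarrow> h e = 1" for h :: "nat set \<Rightarrow> real"
    using FW that by (intro prod.mono_neutral_right) auto
  have "(\<lambda>f. {e \<in> ?V. f e}) -` {E. E \<inter> W = F} = Pi ?V B"
    using FW by (auto simp: B_def Pi_def split: if_splits)
  then have "measure_pmf.prob (random_graph n a) {E. E \<inter> W = F} =
      (\<Prod>e\<in>?V. measure_pmf.prob (bernoulli_pmf a) (B e))"
    by (simp add: random_graph_def measure_Pi_pmf_Pi)
  also have "\<dots> = (\<Prod>e\<in>W. measure_pmf.prob (bernoulli_pmf a) (B e))"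
    by (rule *) (simp add: B_def)
  also have "\<dots> = (\<Prod>e\<in>W. if e \<in> F then a else 1 - a)"
    using a by (intro prod.cong) (auto simp: B_def measure_pmf_single)
  also have "\<dots> = a ^ card (W \<inter> F) * (1 - a) ^ card (W \<inter> - F)"
    using fin by (simp add: prod.If_cases)
  also have "W \<inter> F = F" using FW by auto
  also have "W \<inter> - F = W - F" by auto
  also have "card (W - F) = card W - card F" using FW fin by (simp add: card_Diff_subset)
  finally show ?thesis .
qed

lemma prob_random_graph_superset:
  assumes "0 \<le> a" "a \<le> 1" "F \<subseteq> vertex_pairs n"
  shows "measure_pmf.prob (random_graph n a) {E. F \<subseteq> E} = a ^ card F"
proof -
  have "{E. F \<subseteq> E} = {E. E \<inter> F = F}" by auto
  then show ?thesis using prob_random_graph_Int[of a F F n] assms by simp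
qed

text \<open>Averaging over all colourings: a uniformly random colouring makes a given set of size \<open>s\<close>
  monochromatic with probability \<open>k * (1 / k) ^ s\<close>.\<close>

lemma exists_colouring_few_monochromatic:
  fixes F :: "'i \<Rightarrow> 'e set" and h :: "'i \<Rightarrow> real" and k :: nat
  assumes X: "finite X" and I: "finite I" and F: "\<And>i. i \<in> I \<Longrightarrow> F i \<subseteq> X" and k: "1 \<le> k"
  shows "\<exists>\<kappa>. (\<forall>e\<in>X. \<kappa> e < k) \<and>
    (\<Sum>t<k. \<Sum>i\<in>I. if \<forall>e\<in>F i. \<kappa> e = t then h i else 0) \<le> k * (\<Sum>i\<in>I. h i / k ^ card (F i))"
proof (rule ccontr)
  assume no: "\<not> ?thesis"
  define \<Omega> where "\<Omega> = (\<Pi>\<^sub>E e\<in>X. {..<k})"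
  define m where "m = k * (\<Sum>i\<in>I. h i / k ^ card (F i))"
  have fin: "finite \<Omega>" unfolding \<Omega>_def using X by (intro finite_PiE) auto
  have card\<Omega>: "card \<Omega> = k ^ card X" unfolding \<Omega>_def by (simp add: card_PiE X)
  then have pos: "0 < card \<Omega>" using k by simp
  have gt: "m < (\<Sum>t<k. \<Sum>i\<in>I. if \<forall>e\<in>F i. \<kappa> e = t then h i else 0)" if "\<kappa> \<in> \<Omega>" for \<kappa>
  proof -
    have "\<forall>e\<in>X. \<kappa> e < k" using that by (auto simp: \<Omega>_def)
    with no show ?thesis unfolding m_def by (meson not_less)
  qed
  have cnt: "real (card {\<kappa>\<in>\<Omega>. \<forall>e\<in>F i. \<kappa> e = t}) = real k ^ card X / real k ^ card (F i)"
    if "i \<in> I" "t < k" for i t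
  proof -
    have finF: "finite (F i)" using F[OF that(1)] X finite_subset by blast
    have eq: "{\<kappa>\<in>\<Omega>. \<forall>e\<in>F i. \<kappa> e = t} = (\<Pi>\<^sub>E e\<in>X. if e \<in> F i then {t} else {..<k})"
    proof (rule Set.set_eqI)
      fix \<kappa>
      have "(\<forall>e\<in>X. \<kappa> e < k) \<and> (\<forall>e\<in>F i. \<kappa> e = t) \<longleftrightarrow>
          (\<forall>e\<in>X. \<kappa> e \<in> (if e \<in> F i then {t} else {..<k}))"
        using F[OF that(1)] that(2) by (auto split: if_splits)
      moreover have "\<kappa> \<in> {\<kappa>\<in>\<Omega>. \<forall>e\<in>F i. \<kappa> e = t} \<longleftrightarrow>
          (\<forall>e\<in>X. \<kappa> e < k) \<and> \<kappa> \<in> extensional X \<and> (\<forall>e\<in>F i. \<kappa> e = t)"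
        by (simp add: \<Omega>_def PiE_iff conj_assoc)
      moreover note PiE_iff[of \<kappa> X "\<lambda>e. if e \<in> F i then {t} else {..<k}"]
      ultimately show "\<kappa> \<in> {\<kappa>\<in>\<Omega>. \<forall>e\<in>F i. \<kappa> e = t} \<longleftrightarrow>
          \<kappa> \<in> (\<Pi>\<^sub>E e\<in>X. if e \<in> F i then {t} else {..<k})"
        by argo
    qed
    have "card {\<kappa>\<in>\<Omega>. \<forall>e\<in>F i. \<kappa> e = t} = (\<Prod>e\<in>X. if e \<in> F i then 1 else k)"
      unfolding eq using X by (subst card_PiE) (auto intro!: prod.cong)
    also have "\<dots> = k ^ card (X - F i)"
      using X by (simp add: prod.If_cases Diff_eq)
    also have "card (X - F i) = card X - card (F i)"
      using F[OF that(1)] finF by (simp add: card_Diff_subset)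
    finally have "real (card {\<kappa>\<in>\<Omega>. \<forall>e\<in>F i. \<kappa> e = t}) = real k ^ (card X - card (F i))"
      by simp
    also have "\<dots> = real k ^ card X / real k ^ card (F i)"
      using k card_mono[OF X F[OF that(1)]] by (simp add: power_diff)
    finally show ?thesis .
  qed
  have "card \<Omega> * m = (\<Sum>\<kappa>\<in>\<Omega>. m)" by simp
  also have "\<dots> < (\<Sum>\<kappa>\<in>\<Omega>. \<Sum>t<k. \<Sum>i\<in>I. if \<forall>e\<in>F i. \<kappa> e = t then h i else 0)"
    using fin pos gt by (intro sum_strict_mono) auto
  also have "\<dots> = (\<Sum>t<k. \<Sum>i\<in>I. \<Sum>\<kappa>\<in>\<Omega>. if \<forall>e\<in>F i. \<kappa> e = t then h i else 0)"
    by (subst sum.swap, rule sum.cong[OF refl], rule sum.swap)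
  also have "\<dots> = (\<Sum>t<k. \<Sum>i\<in>I. real (card {\<kappa>\<in>\<Omega>. \<forall>e\<in>F i. \<kappa> e = t}) * h i)"
    using fin by (simp add: sum.If_cases Int_def)
  also have "\<dots> = (\<Sum>t<k. \<Sum>i\<in>I. card \<Omega> * (h i / k ^ card (F i)))"
    by (intro sum.cong) (auto simp: cnt card\<Omega>)
  also have "\<dots> = card \<Omega> * m"
    by (simp add: m_def sum_distrib_left mult_ac)
  finally show False by simp
qed

definition chord_triples :: "nat \<Rightarrow> (nat list \<times> nat set \<times> nat set) set" where
  "chord_triples n = {(vs, e1, e2). distinct vs \<and> set vs \<subseteq> {1..n} \<and> e1 \<subseteq> set vs \<and> e2 \<subseteq> set vs \<and>
     card e1 = 2 \<and> card e2 = 2 \<and> e1 \<noteq> e2 \<and> e1 \<notin> path_edges vs \<and> e2 \<notin> path_edges vs}"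

definition chord_edges :: "nat list \<times> nat set \<times> nat set \<Rightarrow> nat set set" where
  "chord_edges = (\<lambda>(vs, e1, e2). insert e1 (insert e2 (path_edges vs)))"

lemma path_edges_vertex_pairs:
  "distinct vs \<Longrightarrow> set vs \<subseteq> {1..n} \<Longrightarrow> path_edges vs \<subseteq> vertex_pairs n"
proof (induction vs rule: path_edges.induct)
  case (1 x y zs)
  then have "{x, y} \<in> vertex_pairs n" by (simp add: vertex_pairs_def)
  with 1 show ?case by simp
qed simp_all

lemma chord_edges_vertex_pairs:
  assumes "x \<in> chord_triples n"
  shows "chord_edges x \<subseteq> vertex_pairs n"
proof -
  obtain vs e1 e2 where x: "x = (vs, e1, e2)" by (cases x)
  then have "path_edges vs \<subseteq> vertex_pairs n"
    using assms by (intro path_edges_vertex_pairs) (auto simp: chord_triples_def)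
  moreover have "e1 \<in> vertex_pairs n" "e2 \<in> vertex_pairs n"
    using assms by (auto simp: x chord_triples_def vertex_pairs_def)
  ultimately show ?thesis by (simp add: x chord_edges_def)
qed

lemma card_chord_edges:
  assumes "(vs, e1, e2) \<in> chord_triples n"
  shows "card (chord_edges (vs, e1, e2)) = length vs + 1"
proof -
  have "vs \<noteq> []" using assms by (auto simp: chord_triples_def)
  then have "0 < length vs" by simp
  with assms card_path_edges[of vs] show ?thesis
    by (simp add: chord_triples_def chord_edges_def)
qed

lemma orientable_if_no_monochromatic_chords:
  assumes E: "E \<subseteq> vertex_pairs n" and \<kappa>: "\<And>e. e \<in> E \<Longrightarrow> \<kappa> e < k"
    and none: "\<And>x t. x \<in> chord_triples n \<Longrightarrow> t < k \<Longrightarrow> chord_edges x \<subseteq> E \<Longrightarrow> \<exists>e\<in>chord_edges x. \<kappa> e \<noteq> t"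
  shows "\<exists>g. \<forall>e\<in>E. \<exists>t<k. \<exists>v. e = {v, g t v}"
proof -
  have fin: "finite E" using E finite_subset finite_vertex_pairs by blast
  have card2: "card e = 2" if "e \<in> E" for e using that E by (auto simp: vertex_pairs_def)
  have "\<exists>f. \<forall>e\<in>{e\<in>E. \<kappa> e = t}. \<exists>v. e = {v, f v}" if t: "t < k" for t
  proof (rule pseudoforest_orientation)
    fix vs e1 e2
    show "\<not> chorded_path {e \<in> E. \<kappa> e = t} vs e1 e2"
    proof
      assume *: "chorded_path {e \<in> E. \<kappa> e = t} vs e1 e2"
      have sub: "set vs \<subseteq> {1..n}"
      proof -
        have "set vs \<subseteq> \<Union>(path_edges vs)" if "2 \<le> length vs"
          using that
        proof (induction vs rule: path_edges.induct)
          case (1 x y zs)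
          then show ?case by (cases zs) auto
        qed auto
        moreover have "2 \<le> length vs"
        proof -
          have "e1 \<subseteq> set vs" "card e1 = 2" using * card2 by (auto simp: chorded_path_def)
          then have "2 \<le> card (set vs)" by (metis List.finite_set card_mono)
          then show ?thesis using card_length[of vs] by linarith
        qed
        ultimately have "set vs \<subseteq> \<Union>E" using * by (fastforce simp: chorded_path_def)
        also have "\<dots> \<subseteq> {1..n}" using E by (auto simp: vertex_pairs_def)
        finally show ?thesis .
      qed
      have "(vs, e1, e2) \<in> chord_triples n"
        using * sub card2 by (auto simp: chord_triples_def chorded_path_def)
      from none[OF this t] * show False
        by (auto simp: chord_edges_def chorded_path_def subset_iff)
    qed
  qed (use fin card2 in auto)
  then obtain g where "\<forall>t<k. \<forall>e\<in>{e\<in>E. \<kappa> e = t}. \<exists>v. e = {v, g t v}" by metis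
  then show ?thesis using \<kappa> by (intro exI[of _ g]) blast
qed

lemma sum_chord_triples_le:
  fixes q :: real
  assumes "0 \<le> q" "1 \<le> n"
  shows "finite (chord_triples n)"
    "(\<Sum>x\<in>chord_triples n. (q / n) ^ card (chord_edges x)) \<le> q / n * (\<Sum>s\<le>n. real s ^ 4 * q ^ s)"
proof -
  define Ls where "Ls s = {vs :: nat list. set vs \<subseteq> {1..n} \<and> length vs = s}" for s
  define Es where "Es vs = {e. e \<subseteq> set vs \<and> card e = 2}" for vs :: "nat list"
  have finL: "finite (Ls s)" for s unfolding Ls_def by (rule finite_lists_length_eq) simp
  have cardL: "card (Ls s) = n ^ s" for s
    unfolding Ls_def by (subst card_lists_length_eq) auto
  have finE: "finite (Es vs)" for vs unfolding Es_def by (rule finite_subset[of _ "Pow (set vs)"]) auto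
  have cardE: "card (Es vs) \<le> length vs ^ 2" for vs
  proof -
    have "Es vs \<subseteq> (\<lambda>(x, y). {x, y}) ` (set vs \<times> set vs)"
      by (auto simp: Es_def card_2_iff)
    then have "card (Es vs) \<le> card (set vs \<times> set vs)"
      by (meson card_image_le card_mono finite_SigmaI finite_imageI finite_set le_trans)
    also have "\<dots> \<le> length vs * length vs"
      by (simp add: card_cartesian_product card_length mult_le_mono)
    finally show ?thesis by (simp add: power2_eq_square)
  qed
  define U where "U = Sigma (\<Union>s\<le>n. Ls s) (\<lambda>vs. Es vs \<times> Es vs)"
  have finU: "finite U" unfolding U_def using finL finE by auto
  have sub: "chord_triples n \<subseteq> U"
  proof
    fix x assume x: "x \<in> chord_triples n"
    obtain vs e1 e2 where eq: "x = (vs, e1, e2)" by (cases x)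
    have "length vs = card (set vs)" using x by (simp add: eq chord_triples_def distinct_card)
    also have "\<dots> \<le> card {1..n}" using x by (intro card_mono) (auto simp: eq chord_triples_def)
    finally show "x \<in> U" using x by (auto simp: eq U_def chord_triples_def Ls_def Es_def)
  qed
  then show "finite (chord_triples n)" using finU finite_subset by blast
  have "(\<Sum>x\<in>chord_triples n. (q / n) ^ card (chord_edges x)) =
      (\<Sum>x\<in>chord_triples n. (q / n) ^ (length (fst x) + 1))"
    by (rule sum.cong) (auto simp: card_chord_edges)
  also have "\<dots> \<le> (\<Sum>x\<in>U. (q / n) ^ (length (fst x) + 1))"
    using sub finU assms by (intro sum_mono2) auto
  also have "\<dots> = (\<Sum>vs\<in>(\<Union>s\<le>n. Ls s). \<Sum>y\<in>Es vs \<times> Es vs. (q / n) ^ (length vs + 1))"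
    unfolding U_def using finL finE by (subst sum.Sigma) (auto intro!: sum.cong)
  also have "\<dots> = (\<Sum>s\<le>n. \<Sum>vs\<in>Ls s. \<Sum>y\<in>Es vs \<times> Es vs. (q / n) ^ (length vs + 1))"
    by (rule sum.UNION_disjoint) (use finL in \<open>auto simp: Ls_def\<close>)
  also have "\<dots> \<le> (\<Sum>s\<le>n. \<Sum>vs\<in>Ls s. real s ^ 4 * (q / n) ^ (s + 1))"
  proof (intro sum_mono)
    fix s vs assume vs: "vs \<in> Ls s"
    have "(\<Sum>y\<in>Es vs \<times> Es vs. (q / n) ^ (length vs + 1)) = real (card (Es vs) * card (Es vs)) * (q / n) ^ (s + 1)"
      using vs by (simp add: card_cartesian_product Ls_def)
    also have "\<dots> \<le> real (s ^ 2 * s ^ 2) * (q / n) ^ (s + 1)"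
      using cardE[of vs] vs assms
      by (intro mult_right_mono of_nat_mono mult_le_mono) (auto simp: Ls_def)
    also have "real (s ^ 2 * s ^ 2) = real s ^ 4" by simp
    finally show "(\<Sum>y\<in>Es vs \<times> Es vs. (q / n) ^ (length vs + 1)) \<le> real s ^ 4 * (q / n) ^ (s + 1)" .
  qed
  also have "\<dots> = (\<Sum>s\<le>n. q / n * (real s ^ 4 * q ^ s))"
    using assms by (intro sum.cong) (auto simp: cardL power_divide)
  also have "\<dots> = q / n * (\<Sum>s\<le>n. real s ^ 4 * q ^ s)" by (simp add: sum_distrib_left)
  finally show "(\<Sum>x\<in>chord_triples n. (q / n) ^ card (chord_edges x)) \<le> q / n * (\<Sum>s\<le>n. real s ^ 4 * q ^ s)" .
qed

definition orientable :: "nat \<Rightarrow> nat set set \<Rightarrow> bool" where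
  "orientable k E \<longleftrightarrow> (\<exists>g. \<forall>e\<in>E. \<exists>t<k. \<exists>v. e = {v, g t v})"

lemma prob_not_orientable_le:
  assumes k: "1 \<le> k" and p: "0 \<le> p" "p \<le> n" and n: "1 \<le> n"
  shows "measure_pmf.prob (random_graph n (p / n)) {E. \<not> orientable k E} \<le>
    p / n * (\<Sum>s\<le>n. real s ^ 4 * (p / k) ^ s)"
proof -
  define q where "q = p / k"
  have q: "0 \<le> q" using p by (simp add: q_def)
  let ?P = "measure_pmf.prob (random_graph n (p / n))" and ?X = "chord_triples n"
  note fin = sum_chord_triples_le(1)[OF q n]
  obtain \<kappa> where \<kappa>: "\<forall>e\<in>vertex_pairs n. \<kappa> e < k"
    and le: "(\<Sum>t<k. \<Sum>x\<in>?X. if \<forall>e\<in>chord_edges x. \<kappa> e = t then (p / n) ^ card (chord_edges x) else 0)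
      \<le> k * (\<Sum>x\<in>?X. (p / n) ^ card (chord_edges x) / k ^ card (chord_edges x))"
    using exists_colouring_few_monochromatic[where F = chord_edges and h = "\<lambda>x. (p / n) ^ card (chord_edges x)",
        OF finite_vertex_pairs fin _ k, of n] chord_edges_vertex_pairs[of _ n] by blast
  define Bad where "Bad t = {x\<in>?X. \<forall>e\<in>chord_edges x. \<kappa> e = t}" for t
  have "?P {E. \<not> orientable k E} = ?P ({E. \<not> orientable k E} \<inter> set_pmf (random_graph n (p / n)))"
    by (simp add: measure_Int_set_pmf)
  also have "\<dots> \<le> ?P (\<Union>t<k. \<Union>x\<in>Bad t. {E. chord_edges x \<subseteq> E})"
  proof (intro measure_pmf.finite_measure_mono subsetI)
    fix E assume "E \<in> {E. \<not> orientable k E} \<inter> set_pmf (random_graph n (p / n))"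
    then have no: "\<not> orientable k E" and E: "E \<subseteq> vertex_pairs n"
      using set_pmf_random_graph by auto
    show "E \<in> (\<Union>t<k. \<Union>x\<in>Bad t. {E. chord_edges x \<subseteq> E})"
    proof (rule ccontr)
      assume "E \<notin> (\<Union>t<k. \<Union>x\<in>Bad t. {E. chord_edges x \<subseteq> E})"
      then have "\<exists>e\<in>chord_edges x. \<kappa> e \<noteq> t" if "x \<in> ?X" "t < k" "chord_edges x \<subseteq> E" for x t
        using that unfolding Bad_def by blast
      then have "\<exists>g. \<forall>e\<in>E. \<exists>t<k. \<exists>v. e = {v, g t v}"
        using \<kappa> E by (intro orientable_if_no_monochromatic_chords[of E n \<kappa>]) blast+
      with no show False by (simp add: orientable_def)
    qed
  qed simp
  also have "\<dots> \<le> (\<Sum>t<k. ?P (\<Union>x\<in>Bad t. {E. chord_edges x \<subseteq> E}))"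
    by (intro measure_pmf.finite_measure_subadditive_finite) auto
  also have "\<dots> \<le> (\<Sum>t<k. \<Sum>x\<in>Bad t. ?P {E. chord_edges x \<subseteq> E})"
    using fin by (intro sum_mono measure_pmf.finite_measure_subadditive_finite) (auto simp: Bad_def)
  also have "\<dots> = (\<Sum>t<k. \<Sum>x\<in>Bad t. (p / n) ^ card (chord_edges x))"
    using p n by (intro sum.cong prob_random_graph_superset chord_edges_vertex_pairs) (auto simp: Bad_def)
  also have "\<dots> = (\<Sum>t<k. \<Sum>x\<in>?X. if \<forall>e\<in>chord_edges x. \<kappa> e = t then (p / n) ^ card (chord_edges x) else 0)"
    using fin by (simp add: Bad_def sum.If_cases Int_def)
  also note le
  also have "(\<Sum>x\<in>?X. (p / n) ^ card (chord_edges x) / k ^ card (chord_edges x))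
      = (\<Sum>x\<in>?X. (q / n) ^ card (chord_edges x))"
    by (simp add: q_def power_divide power_mult_distrib mult_ac)
  also have "k * \<dots> \<le> k * (q / n * (\<Sum>s\<le>n. real s ^ 4 * q ^ s))"
    by (intro mult_left_mono sum_chord_triples_le(2) q n) simp
  also have "\<dots> = p / n * (\<Sum>s\<le>n. real s ^ 4 * q ^ s)"
    using k by (simp add: q_def)
  finally show ?thesis by (simp add: q_def)
qed

lemma prob_not_orientable_tendsto_0:
  assumes p: "0 \<le> p" "p < real k"
  shows "(\<lambda>n. measure_pmf.prob (random_graph n (p / n)) {E. \<not> orientable k E}) \<longlonglongrightarrow> 0"
proof -
  define q where "q = p / k"
  have q: "0 \<le> q" "q < 1" using p by (auto simp: q_def)
  have "conv_radius (\<lambda>s. real s ^ 4) = 1"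
  proof (rule conv_radius_ratio_limit_nonzero)
    show "(\<lambda>n. norm (real n ^ 4) / norm (real (Suc n) ^ 4)) \<longlonglongrightarrow> 1"
      unfolding norm_power real_norm_def abs_of_nat by real_asymp
  qed (auto simp: one_ereal_def)
  then have sm: "summable (\<lambda>s. real s ^ 4 * q ^ s)"
    using q by (intro summable_in_conv_radius) (auto simp: one_ereal_def)
  define S where "S = (\<Sum>s. real s ^ 4 * q ^ s)"
  show ?thesis
  proof (rule tendsto_sandwich[of "\<lambda>_. 0"])
    show "eventually (\<lambda>n. measure_pmf.prob (random_graph n (p / n)) {E. \<not> orientable k E} \<le> p / n * S) sequentially"
      using eventually_ge_at_top[of "nat \<lceil>p\<rceil>"] eventually_ge_at_top[of 1]
    proof eventually_elim
      case (elim n)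
      have "measure_pmf.prob (random_graph n (p / n)) {E. \<not> orientable k E} \<le>
          p / n * (\<Sum>s\<le>n. real s ^ 4 * q ^ s)"
        unfolding q_def using p elim by (intro prob_not_orientable_le) (auto simp: nat_ceiling_le_eq)
      also have "\<dots> \<le> p / n * S"
        unfolding S_def using p q sm by (intro mult_left_mono sum_le_suminf) auto
      finally show ?case .
    qed
    show "(\<lambda>n. p / real n * S) \<longlonglongrightarrow> 0"
      by (rule tendsto_mult_left_zero[OF lim_const_over_n])
  qed auto
qed

section \<open>Isolated stars in the random graph\<close>

lemma second_moment_count:
  fixes P :: "'e pmf" and Q :: "'i \<Rightarrow> 'e set" and \<epsilon> N :: real
  assumes I: "finite I" and \<epsilon>: "0 \<le> \<epsilon>"
    and pair: "\<And>i j. i \<in> I \<Longrightarrow> j \<in> I \<Longrightarrow> i \<noteq> j \<Longrightarrow> measure_pmf.prob P (Q i \<inter> Q j) \<le>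
      (1 + \<epsilon>) * (measure_pmf.prob P (Q i) * measure_pmf.prob P (Q j))"
  defines "\<mu> \<equiv> \<Sum>i\<in>I. measure_pmf.prob P (Q i)"
  assumes N: "N < \<mu>"
  shows "measure_pmf.prob P {E. real (card {i\<in>I. E \<in> Q i}) < N} \<le> (\<mu> + \<epsilon> * \<mu>\<^sup>2) / (\<mu> - N)\<^sup>2"
proof -
  define X where "X E = (\<Sum>i\<in>I. indicator (Q i) E :: real)" for E
  have X: "X E = real (card {i\<in>I. E \<in> Q i})" for E
    using I by (simp add: X_def indicator_def sum.If_cases Int_def)
  have X2: "(X E)\<^sup>2 = (\<Sum>i\<in>I. \<Sum>j\<in>I. indicator (Q i \<inter> Q j) E)" for E
    by (simp add: X_def power2_eq_square sum_product indicator_inter_arith)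
  have int: "integrable P X" "integrable P (\<lambda>E. (X E)\<^sup>2)"
    unfolding X2 unfolding X_def by (auto intro!: Bochner_Integration.integrable_sum integrable_real_indicator simp: measure_pmf.emeasure_eq_measure)
  have EX: "measure_pmf.expectation P X = \<mu>"
    unfolding X_def \<mu>_def by (subst Bochner_Integration.integral_sum) (auto simp: measure_pmf.emeasure_eq_measure)
  have "measure_pmf.expectation P (\<lambda>E. (X E)\<^sup>2) = (\<Sum>i\<in>I. \<Sum>j\<in>I. measure_pmf.prob P (Q i \<inter> Q j))"
    unfolding X2 by (simp add: Bochner_Integration.integral_sum measure_pmf.emeasure_eq_measure)
  also have "\<dots> \<le> (\<Sum>i\<in>I. \<Sum>j\<in>I. (if j = i then measure_pmf.prob P (Q i) else 0) +
      (1 + \<epsilon>) * (measure_pmf.prob P (Q i) * measure_pmf.prob P (Q j)))"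
  proof (intro sum_mono)
    fix i j assume ij: "i \<in> I" "j \<in> I"
    show "measure_pmf.prob P (Q i \<inter> Q j) \<le> (if j = i then measure_pmf.prob P (Q i) else 0) +
      (1 + \<epsilon>) * (measure_pmf.prob P (Q i) * measure_pmf.prob P (Q j))"
      using pair[OF ij] \<epsilon> by (cases "i = j") auto
  qed
  also have "\<dots> = \<mu> + (1 + \<epsilon>) * \<mu>\<^sup>2"
  proof -
    have "\<mu>\<^sup>2 = (\<Sum>i\<in>I. \<Sum>j\<in>I. measure_pmf.prob P (Q i) * measure_pmf.prob P (Q j))"
      by (simp add: power2_eq_square \<mu>_def sum_product)
    then show ?thesis
      using I by (simp add: sum.distrib sum_distrib_left \<mu>_def)
  qed
  finally have var: "measure_pmf.variance P X \<le> \<mu> + \<epsilon> * \<mu>\<^sup>2"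
    by (subst measure_pmf.variance_eq[OF int]) (simp add: EX algebra_simps)
  have "measure_pmf.prob P {E. X E < N} \<le> measure_pmf.prob P {E \<in> space P. \<mu> - N \<le> \<bar>X E - \<mu>\<bar>}"
    by (intro measure_pmf.finite_measure_mono) auto
  also have "\<dots> \<le> measure_pmf.variance P X / (\<mu> - N)\<^sup>2"
    using measure_pmf.Chebyshev_inequality[of X P "\<mu> - N"] int N EX by simp
  also have "\<dots> \<le> (\<mu> + \<epsilon> * \<mu>\<^sup>2) / (\<mu> - N)\<^sup>2"
    by (intro divide_right_mono var) simp
  finally show ?thesis by (simp add: X)
qed

definition touching :: "nat \<Rightarrow> nat set \<Rightarrow> nat set set" where
  "touching n S = {e \<in> vertex_pairs n. e \<inter> S \<noteq> {}}"

definition star_edges :: "nat \<times> nat set \<Rightarrow> nat set set" where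
  "star_edges = (\<lambda>(u, L). (\<lambda>v. {u, v}) ` L)"

definition star_places :: "nat \<Rightarrow> nat \<Rightarrow> (nat \<times> nat set) set" where
  "star_places n m = (SIGMA u:{1..n}. {L. L \<subseteq> {1..n} - {u} \<and> card L = m})"

definition star_event :: "nat \<Rightarrow> nat \<times> nat set \<Rightarrow> nat set set set" where
  "star_event n = (\<lambda>(u, L). {E. E \<inter> touching n (insert u L) = star_edges (u, L)})"

lemma touching_subset: "touching n S \<subseteq> vertex_pairs n"
  by (auto simp: touching_def)

lemma finite_touching [simp]: "finite (touching n S)"
  using finite_subset[OF touching_subset finite_vertex_pairs] .

lemma card_touching_Int_le:
  assumes "S \<subseteq> {1..n}" "S' \<subseteq> {1..n}"
  shows "S \<inter> S' = {} \<Longrightarrow> card (touching n S \<inter> touching n S') \<le> card S * card S'"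
    and "card (touching n S) \<le> card S * n"
proof -
  have fin: "finite S" "finite S'" using assms finite_subset by blast+
  {
    assume "S \<inter> S' = {}"
    then have "touching n S \<inter> touching n S' \<subseteq> (\<lambda>(x, y). {x, y}) ` (S \<times> S')"
      by (fastforce simp: touching_def vertex_pairs_def card_2_iff)
    then have "card (touching n S \<inter> touching n S') \<le> card ((\<lambda>(x, y). {x, y}) ` (S \<times> S'))"
      using fin by (intro card_mono) auto
    also have "\<dots> \<le> card (S \<times> S')" using fin by (intro card_image_le) auto
    finally show "card (touching n S \<inter> touching n S') \<le> card S * card S'"
      by (simp add: card_cartesian_product)
  }
  have "touching n S \<subseteq> (\<lambda>(x, y). {x, y}) ` (S \<times> {1..n})"
  proof
    fix e assume "e \<in> touching n S"
    then obtain x where x: "x \<in> e" "x \<in> S" and e: "e \<subseteq> {1..n}" "card e = 2"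
      by (auto simp: touching_def vertex_pairs_def)
    from e(2) obtain v v' where "e = {v, v'}" by (auto simp: card_2_iff)
    with x(1) obtain y where "e = {x, y}" by (metis insert_commute insertE singletonD)
    with x e have "e = {x, y}" "x \<in> S" "y \<in> {1..n}" by auto
    then show "e \<in> (\<lambda>(x, y). {x, y}) ` (S \<times> {1..n})" by (intro image_eqI[of _ _ "(x, y)"]) auto
  qed
  then have "card (touching n S) \<le> card ((\<lambda>(x, y). {x, y}) ` (S \<times> {1..n}))"
    using fin by (intro card_mono) auto
  also have "\<dots> \<le> card (S \<times> {1..n})" using fin by (intro card_image_le) auto
  finally show "card (touching n S) \<le> card S * n"
    by (simp add: card_cartesian_product)
qed

lemma star_places_facts:
  assumes "(u, L) \<in> star_places n m"
  shows "finite L" "u \<notin> L" "card L = m" "insert u L \<subseteq> {1..n}" "card (insert u L) = m + 1"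
    "card (star_edges (u, L)) = m" "star_edges (u, L) \<subseteq> touching n (insert u L)"
proof -
  show L: "finite L" "u \<notin> L" "card L = m" "insert u L \<subseteq> {1..n}"
    using assms finite_subset[of L "{1..n}"] by (auto simp: star_places_def)
  then show "card (insert u L) = m + 1" by simp
  have "inj_on (\<lambda>v. {u, v}) L" using L by (auto simp: inj_on_def doubleton_eq_iff)
  then show "card (star_edges (u, L)) = m" using L by (simp add: star_edges_def card_image)
  show "star_edges (u, L) \<subseteq> touching n (insert u L)"
    using L by (auto simp: star_edges_def touching_def vertex_pairs_def card_2_iff)
qed

lemma star_event_isolated_star:
  assumes st: "(u, L) \<in> star_places n m" and E: "E \<subseteq> vertex_pairs n" "E \<in> star_event n (u, L)"
  shows "isolated_star E (u, L)"
proof -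
  note f = star_places_facts[OF st]
  have mem: "e \<in> E \<longleftrightarrow> e \<in> star_edges (u, L)" if "e \<inter> insert u L \<noteq> {}" for e
    using E that f(7) by (auto simp: star_event_def touching_def)
  have "{u, v} \<in> E \<longleftrightarrow> v \<in> L" for v
    using mem[of "{u, v}"] f(2) by (auto simp: star_edges_def doubleton_eq_iff)
  moreover have "{x, v} \<in> E \<longleftrightarrow> v = u" if "x \<in> L" for x v
    using mem[of "{x, v}"] f(2) that by (auto simp: star_edges_def doubleton_eq_iff)
  ultimately show ?thesis using f(2) by (simp add: isolated_star_def)
qed

lemma finite_star_places [simp]: "finite (star_places n m)"
  unfolding star_places_def by (intro finite_SigmaI) (auto intro: finite_subset[of _ "Pow {1..n}"])

lemma card_star_places: "card (star_places n m) = n * ((n - 1) choose m)"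
proof -
  have "card (star_places n m) = (\<Sum>u\<in>{1..n}. card {L. L \<subseteq> {1..n} - {u} \<and> card L = m})"
    unfolding star_places_def by (rule card_SigmaI) (auto intro: finite_subset[of _ "Pow {1..n}"])
  also have "\<dots> = (\<Sum>u\<in>{1..n}. (n - 1) choose m)"
    by (intro sum.cong refl, subst n_subsets) auto
  finally show ?thesis by simp
qed

context
  fixes a :: real and n m :: nat
  assumes a: "0 \<le> a" "a < 1"
begin

lemma prob_star_event:
  assumes "(u, L) \<in> star_places n m"
  shows "measure_pmf.prob (random_graph n a) (star_event n (u, L)) =
    a ^ m * (1 - a) ^ (card (touching n (insert u L)) - m)"
proof -
  note f = star_places_facts[OF assms]
  show ?thesis
    using prob_random_graph_Int[OF a(1) less_imp_le[OF a(2)] f(7) touching_subset]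
    unfolding f(6) star_event_def by simp
qed

lemma prob_star_event_ge:
  assumes "T \<in> star_places n m"
  shows "a ^ m * (1 - a) ^ ((m + 1) * n) \<le> measure_pmf.prob (random_graph n a) (star_event n T)"
proof -
  obtain u L where T: "T = (u, L)" by force
  note f = star_places_facts[OF assms[unfolded T]]
  have "card (touching n (insert u L)) \<le> (m + 1) * n"
    using card_touching_Int_le(2)[OF f(4) order_refl] f(5) by simp
  then show ?thesis
    unfolding T prob_star_event[OF assms[unfolded T]] using a
    by (intro mult_left_mono power_decreasing) auto
qed

lemma prob_star_event_pair_le:
  assumes T: "T \<in> star_places n m" "T' \<in> star_places n m" "T \<noteq> T'" and m: "2 \<le> m"
  shows "measure_pmf.prob (random_graph n a) (star_event n T \<inter> star_event n T') \<le>
    1 / (1 - a) ^ ((m + 1)\<^sup>2) * (measure_pmf.prob (random_graph n a) (star_event n T) *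
      measure_pmf.prob (random_graph n a) (star_event n T'))"
proof -
  let ?P = "measure_pmf.prob (random_graph n a)"
  obtain u L u' L' where eq: "T = (u, L)" "T' = (u', L')" by (cases T, cases T') auto
  note st = T(1)[unfolded eq] T(2)[unfolded eq]
  note f = star_places_facts[OF st(1)] and f' = star_places_facts[OF st(2)]
  define S where "S = insert u L"
  define S' where "S' = insert u' L'"
  show ?thesis
  proof (cases "S \<inter> S' = {}")
    case False
    have "set_pmf (random_graph n a) \<inter> (star_event n T \<inter> star_event n T') = {}"
    proof (rule ccontr)
      assume "\<not> ?thesis"
      then obtain E where E: "E \<in> set_pmf (random_graph n a)" "E \<in> star_event n T" "E \<in> star_event n T'"
        by auto
      then have "E \<subseteq> vertex_pairs n" using set_pmf_random_graph by auto
      with E st have "isolated_star E (u, L)" "isolated_star E (u', L')"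
        by (auto simp: eq intro: star_event_isolated_star)
      then have "S \<inter> S' = {}"
        unfolding S_def S'_def using f f' m T(3) by (intro isolated_stars_disjoint) (auto simp: eq)
      with False show False by simp
    qed
    then have "?P (star_event n T \<inter> star_event n T') = 0" by (simp add: measure_pmf_zero_iff)
    then show ?thesis using a by simp
  next
    case True
    define F where "F = star_edges (u, L)"
    define F' where "F' = star_edges (u', L')"
    define W where "W = touching n S"
    define W' where "W' = touching n S'"
    have fin: "finite F" "finite F'" "finite W" "finite W'"
      using f(1) f'(1) by (auto simp: F_def F'_def W_def W'_def star_edges_def)
    have sub: "F \<subseteq> W" "F' \<subseteq> W'" using f(7) f'(7) by (auto simp: F_def F'_def W_def W'_def S_def S'_def)
    have disj: "F \<inter> F' = {}"
      using True by (auto simp: F_def F'_def star_edges_def S_def S'_def doubleton_eq_iff)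
    have "star_event n T \<inter> star_event n T' \<subseteq> {E. E \<inter> (W \<union> W') = F \<union> F'}"
      by (auto simp: star_event_def eq F_def F'_def W_def W'_def S_def S'_def)
    then have "?P (star_event n T \<inter> star_event n T') \<le> ?P {E. E \<inter> (W \<union> W') = F \<union> F'}"
      by (intro measure_pmf.finite_measure_mono) auto
    also have "\<dots> = a ^ card (F \<union> F') * (1 - a) ^ (card (W \<union> W') - card (F \<union> F'))"
      using sub a touching_subset by (intro prob_random_graph_Int) (auto simp: W_def W'_def)
    also have "card (F \<union> F') = m + m"
      using disj fin f(6) f'(6) by (simp add: card_Un_disjoint F_def F'_def)
    also have "(1 - a) ^ (card (W \<union> W') - (m + m)) \<le>
        (1 - a) ^ (card W - m + (card W' - m)) / (1 - a) ^ ((m + 1)\<^sup>2)"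
    proof -
      have "card (W \<inter> W') \<le> (m + 1)\<^sup>2"
        using card_touching_Int_le(1)[of S n S', OF _ _ True] f f'
        by (simp add: W_def W'_def S_def S'_def power2_eq_square)
      moreover have "card W + card W' = card (W \<union> W') + card (W \<inter> W')"
        using fin by (intro card_Un_Int)
      moreover have "m \<le> card W" "m \<le> card W'"
        using card_mono[OF fin(3) sub(1)] card_mono[OF fin(4) sub(2)] f(6) f'(6)
        by (simp_all add: F_def F'_def)
      ultimately have "card W - m + (card W' - m) \<le> card (W \<union> W') - (m + m) + (m + 1)\<^sup>2"
        by linarith
      then have "(1 - a) ^ (card (W \<union> W') - (m + m) + (m + 1)\<^sup>2) \<le> (1 - a) ^ (card W - m + (card W' - m))"
        using a by (intro power_decreasing) auto
      then show ?thesis using a by (simp add: power_add pos_le_divide_eq)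
    qed
    also have "a ^ (m + m) * ((1 - a) ^ (card W - m + (card W' - m)) / (1 - a) ^ ((m + 1)\<^sup>2)) =
        1 / (1 - a) ^ ((m + 1)\<^sup>2) * (?P (star_event n T) * ?P (star_event n T'))"
      by (simp add: eq prob_star_event[OF st(1)] prob_star_event[OF st(2)] W_def W'_def S_def S'_def power_add)
    finally show ?thesis using a by (simp add: mult_left_mono)
  qed
qed

end

lemma prob_few_isolated_stars_tendsto_0:
  fixes p :: real and m N :: nat
  assumes p: "0 < p" and m: "2 \<le> m"
  shows "(\<lambda>n. measure_pmf.prob (random_graph n (p / n))
    {E. card {T \<in> star_places n m. E \<in> star_event n T} < N}) \<longlonglongrightarrow> 0"
proof -
  define \<mu> where "\<mu> n = (\<Sum>T\<in>star_places n m. measure_pmf.prob (random_graph n (p / n)) (star_event n T))" for n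
  define \<epsilon> where "\<epsilon> n = 1 / (1 - p / real n) ^ ((m + 1)\<^sup>2) - 1" for n :: nat
  define \<nu> where "\<nu> n = real n * ((((real n - 1) / m) * (p / real n)) ^ m * ((1 - p / real n) ^ n) ^ (m + 1))" for n :: nat
  have \<epsilon>: "\<epsilon> \<longlonglongrightarrow> 0"
  proof -
    have "(\<lambda>n. 1 / (1 - p / real n) ^ ((m + 1)\<^sup>2) - 1) \<longlonglongrightarrow> 1 / (1 - 0) ^ ((m + 1)\<^sup>2) - 1"
      by (intro tendsto_intros lim_const_over_n) auto
    then show ?thesis by (simp add: \<epsilon>_def[abs_def])
  qed
  have \<nu>: "filterlim \<nu> at_top sequentially"
  proof -
    have 1: "(\<lambda>n. ((real n - 1) / m) * (p / real n)) \<longlonglongrightarrow> p / m"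
    proof -
      have lim: "(\<lambda>n. (1 - 1 / real n) * (p / m)) \<longlonglongrightarrow> (1 - 0) * (p / m)"
        by (intro tendsto_intros lim_const_over_n)
      have ev: "eventually (\<lambda>n. (1 - 1 / real n) * (p / m) = ((real n - 1) / m) * (p / real n)) sequentially"
        using eventually_gt_at_top[of 0] by eventually_elim (use m in \<open>simp add: field_simps\<close>)
      from iffD1[OF tendsto_cong[OF ev] lim] show ?thesis by simp
    qed
    have 2: "(\<lambda>n. (1 - p / real n) ^ n) \<longlonglongrightarrow> exp (- p)"
      using tendsto_exp_limit_sequentially[of "- p"] by simp
    have 3: "(\<lambda>n. (((real n - 1) / m) * (p / real n)) ^ m * ((1 - p / real n) ^ n) ^ (m + 1))
        \<longlonglongrightarrow> (p / m) ^ m * exp (- p) ^ (m + 1)"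
      by (intro tendsto_intros 1 2)
    have "0 < (p / m) ^ m * exp (- p) ^ (m + 1)" using p m by simp
    from filterlim_tendsto_pos_mult_at_top[OF 3 this filterlim_real_sequentially]
    show ?thesis by (simp add: \<nu>_def[abs_def] mult_ac)
  qed
  have big: "eventually (\<lambda>n. \<nu> n \<le> \<mu> n \<and> measure_pmf.prob (random_graph n (p / n))
      {E. card {T \<in> star_places n m. E \<in> star_event n T} < N} \<le> 4 * (1 / \<nu> n + \<epsilon> n)) sequentially"
    using eventually_ge_at_top[of "m + 1"] eventually_gt_at_top[of "nat \<lceil>p\<rceil>"]
      filterlim_at_top_dense[THEN iffD1, OF \<nu>, rule_format, of "2 * real N"]
      filterlim_at_top_dense[THEN iffD1, OF \<nu>, rule_format, of 0]
  proof eventually_elim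
    case (elim n)
    have pn: "0 \<le> p / n" "p / n < 1" using elim(1,2) p by (auto simp: field_simps) linarith
    have n1: "real (n - 1) = real n - 1" using elim(1) by simp
    have "\<nu> n = real n * (((real (n - 1)) / m) ^ m * ((p / n) ^ m * (1 - p / n) ^ ((m + 1) * n)))"
      by (simp only: \<nu>_def n1 power_mult_distrib power_mult[symmetric] mult_ac)
    also have "\<dots> \<le> real n * (real ((n - 1) choose m) * ((p / n) ^ m * (1 - p / n) ^ ((m + 1) * n)))"
      using elim(1) pn by (intro mult_left_mono mult_right_mono binomial_ge_n_over_k_pow_k) auto
    also have "\<dots> = (\<Sum>T\<in>star_places n m. (p / n) ^ m * (1 - p / n) ^ ((m + 1) * n))"
      by (simp add: card_star_places)
    also have "\<dots> \<le> \<mu> n"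
      unfolding \<mu>_def by (intro sum_mono prob_star_event_ge pn)
    finally have \<nu>\<mu>: "\<nu> n \<le> \<mu> n" .
    with elim have \<mu>: "2 * real N < \<mu> n" "0 < \<mu> n" by auto
    have \<epsilon>0: "0 \<le> \<epsilon> n"
    proof -
      have "(1 - p / n) ^ ((m + 1)\<^sup>2) \<le> 1" using pn by (intro power_le_one) auto
      moreover have "0 < (1 - p / n) ^ ((m + 1)\<^sup>2)" using pn by simp
      ultimately show ?thesis by (simp add: \<epsilon>_def)
    qed
    have "measure_pmf.prob (random_graph n (p / n)) {E. real (card {T \<in> star_places n m. E \<in> star_event n T}) < real N}
        \<le> (\<mu> n + \<epsilon> n * (\<mu> n)\<^sup>2) / (\<mu> n - real N)\<^sup>2"
      unfolding \<mu>_def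
    proof (rule second_moment_count[OF finite_star_places \<epsilon>0])
      show "measure_pmf.prob (random_graph n (p / n)) (star_event n T \<inter> star_event n T') \<le>
        (1 + \<epsilon> n) * (measure_pmf.prob (random_graph n (p / n)) (star_event n T) *
          measure_pmf.prob (random_graph n (p / n)) (star_event n T'))"
        if "T \<in> star_places n m" "T' \<in> star_places n m" "T \<noteq> T'" for T T'
        using prob_star_event_pair_le[OF pn that m] by (simp add: \<epsilon>_def)
    qed (use \<mu> in \<open>simp add: \<mu>_def\<close>)
    also have "\<dots> \<le> (\<mu> n + \<epsilon> n * (\<mu> n)\<^sup>2) / (\<mu> n / 2)\<^sup>2"
      using \<mu> \<epsilon>0 by (intro divide_left_mono power_mono mult_pos_pos zero_less_power) auto
    also have "\<dots> = 4 * (1 / \<mu> n + \<epsilon> n)"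
      using \<mu>(2) by (simp add: field_simps power2_eq_square)
    also have "\<dots> \<le> 4 * (1 / \<nu> n + \<epsilon> n)"
      using \<nu>\<mu> elim(4) by (intro mult_left_mono add_right_mono divide_left_mono) auto
    finally show ?case using \<nu>\<mu> by simp
  qed
  have lim: "(\<lambda>n. 4 * (1 / \<nu> n + \<epsilon> n)) \<longlonglongrightarrow> 4 * (0 + 0)"
    by (intro tendsto_intros \<epsilon> tendsto_divide_0[OF tendsto_const] filterlim_at_top_imp_at_infinity \<nu>)
  show ?thesis
  proof (rule tendsto_sandwich[of "\<lambda>_. 0"])
    show "eventually (\<lambda>n. measure_pmf.prob (random_graph n (p / n))
        {E. card {T \<in> star_places n m. E \<in> star_event n T} < N} \<le> 4 * (1 / \<nu> n + \<epsilon> n)) sequentially"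
      using big by (rule eventually_mono) simp
    show "(\<lambda>n. 4 * (1 / \<nu> n + \<epsilon> n)) \<longlonglongrightarrow> 0" using lim by simp
  qed auto
qed

lemma tau_less_star_eigenvalue:
  fixes c b :: real
  assumes c: "0 < c" and b: "b < tau c"
  shows "\<exists>m\<ge>2::nat. b < sqrt (m / ((m + c) * (1 + c)))"
proof -
  have "(\<lambda>m. real m / (real m + c)) \<longlonglongrightarrow> 1" using c by real_asymp
  then have "(\<lambda>m. sqrt (real m / (real m + c) / (1 + c))) \<longlonglongrightarrow> sqrt (1 / (1 + c))"
    using c by (intro tendsto_intros) auto
  moreover have "b < sqrt (1 / (1 + c))" using b by (simp add: tau_def real_sqrt_divide)
  ultimately have "eventually (\<lambda>m. b < sqrt (real m / (real m + c) / (1 + c))) sequentially"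
    by (rule order_tendstoD)
  from eventually_conj[OF this eventually_ge_at_top[of 2]]
  obtain m where "2 \<le> m" "b < sqrt (real m / (real m + c) / (1 + c))"
    by (auto simp: eventually_sequentially)
  then show ?thesis by (intro exI[of _ m]) simp
qed

theorem theorem1:
  fixes c p b :: real and k :: int and l :: nat
  assumes "c > 0" and "p > 0"
    and "k = \<lfloor>p\<rfloor> + 1"
    and "l \<ge> 1"
    and "0 < b" and "b < tau c"
  shows "(\<lambda>n. measure_pmf.prob (random_graph n (p / real n))
            {E. b \<le> nth_eigenvalue (n - l) (M_mat c n E)
                \<and> nth_eigenvalue (n - l) (M_mat c n E) \<le> tau (c / real_of_int k)
                \<and> - tau (c / real_of_int k) \<le> nth_eigenvalue l (M_mat c n E)
                \<and> nth_eigenvalue l (M_mat c n E) \<le> - b})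
         \<longlonglongrightarrow> 1"
proof -
  define K where "K = nat k"
  have K: "1 \<le> K" "real K = real_of_int k" "p < real K"
    using assms(2,3) by (auto simp: K_def) linarith+
  obtain m :: nat where m: "2 \<le> m" "b < sqrt (m / ((m + c) * (1 + c)))"
    using tau_less_star_eigenvalue[OF assms(1,6)] by blast
  define \<theta> where "\<theta> = sqrt (m / ((m + c) * (1 + c)))"
  have \<theta>: "\<theta> * \<theta> * (1 + c) * (m + c) = m" "b < \<theta>" "\<theta> \<noteq> 0"
    using m assms(1,5) by (auto simp: \<theta>_def)
  define Good where "Good n = {E. b \<le> nth_eigenvalue (n - l) (M_mat c n E)
                \<and> nth_eigenvalue (n - l) (M_mat c n E) \<le> tau (c / real_of_int k)
                \<and> - tau (c / real_of_int k) \<le> nth_eigenvalue l (M_mat c n E)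
                \<and> nth_eigenvalue l (M_mat c n E) \<le> - b}" for n
  define B1 where "B1 = {E. \<not> orientable K E}"
  define B2 where "B2 n = {E. card {T \<in> star_places n m. E \<in> star_event n T} < l + 2}" for n
  let ?P = "\<lambda>n. measure_pmf.prob (random_graph n (p / real n))"
  have good: "E \<in> Good n" if EG: "E \<subseteq> vertex_pairs n" "E \<notin> B1" "E \<notin> B2 n" and n: "l + 1 \<le> n" for E n
  proof -
    interpret positive_parameter c n E by unfold_locales (fact assms(1), fact EG(1))
    from EG(2) obtain g where g: "\<forall>e\<in>E. \<exists>t<K. \<exists>v. e = {v, g t v}"
      by (auto simp: B1_def orientable_def)
    have upper: "nth_eigenvalue (n - l) (M_mat c n E) \<le> tau (c / real_of_int k)"
      "- tau (c / real_of_int k) \<le> nth_eigenvalue l (M_mat c n E)"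
      using orientable_spectrum_bounds[OF K(1), of g l] g n assms(4) K(2) by auto
    define Ts where "Ts = {T \<in> star_places n m. E \<in> star_event n T}"
    have Ts: "finite Ts" "l + 2 \<le> card Ts" using EG(3) by (auto simp: Ts_def B2_def)
    have star: "isolated_star E T \<and> card (snd T) = m" if "T \<in> Ts" for T
    proof -
      obtain u L where T: "T = (u, L)" by force
      then show ?thesis
        using that star_event_isolated_star[of u L n m E] star_places_facts(3)[of u L n m] EG(1)
        by (auto simp: Ts_def)
    qed
    have "\<theta> \<le> nth_eigenvalue (n - l) (M_mat c n E)"
      by (rule isolated_stars_spectrum_bounds(1)[OF Ts star m(1) assms(4) \<theta>(1,3)])
    moreover have "nth_eigenvalue l (M_mat c n E) \<le> - \<theta>"
      by (rule isolated_stars_spectrum_bounds(2)[OF Ts star m(1) assms(4)]) (use \<theta> in auto)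
    ultimately show ?thesis using upper \<theta>(2) by (simp add: Good_def)
  qed
  have ev: "eventually (\<lambda>n. 1 - (?P n B1 + ?P n (B2 n)) \<le> ?P n (Good n)) sequentially"
    using eventually_ge_at_top[of "l + 1"]
  proof eventually_elim
    case (elim n)
    have "1 = ?P n (set_pmf (random_graph n (p / n)))"
      by (simp add: measure_pmf.prob_eq_1 AE_measure_pmf)
    also have "\<dots> \<le> ?P n (Good n \<union> (B1 \<union> B2 n))"
    proof (rule measure_pmf.finite_measure_mono)
      show "set_pmf (random_graph n (p / n)) \<subseteq> Good n \<union> (B1 \<union> B2 n)"
        using good[OF _ _ _ elim] set_pmf_random_graph[of n "p / n"] by blast
    qed simp
    also have "\<dots> \<le> ?P n (Good n) + (?P n B1 + ?P n (B2 n))"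
      by (rule order_trans[OF measure_Un_le add_left_mono[OF measure_Un_le]]) auto
    finally show ?case by simp
  qed
  have "(\<lambda>n. 1 - (?P n B1 + ?P n (B2 n))) \<longlonglongrightarrow> 1 - (0 + 0)"
    unfolding B1_def B2_def using assms(2) K(3) m(1)
    by (intro tendsto_intros prob_not_orientable_tendsto_0 prob_few_isolated_stars_tendsto_0) auto
  then have "(\<lambda>n. ?P n (Good n)) \<longlonglongrightarrow> 1"
    by (intro tendsto_sandwich[OF ev always_eventually _ tendsto_const]) auto
  then show ?thesis by (simp add: Good_def)
qed

end
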